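(* Let $1<p<\infty$, and let $r_1,r_2\ge 0$ and $s_1,s_2>0$ be real numbers. Let $T_0:\ell_p\to\ell_p$ be the bounded linear operator given, for $x=\{x_n\}_{n\ge1}$ (with $x_{-1}=x_0=0$), by $(T_0x)_n=s_1x_{n-2}+r_1x_n+s_1x_{n+2}$ if $n$ is odd and $(T_0x)_n=s_2x_{n-2}+r_2x_n+s_2x_{n+2}$ if $n$ is even. Then the compression spectrum, approximate point spectrum and defect spectrum of $T_0$ over $\ell_p$ are: (i) $\sigma_{co}(T_0,\ell_p)=\emptyset$; (ii) $\sigma_{app}(T_0,\ell_p)=[r_1-2s_1,r_1+2s_1]\cup[r_2-2s_2,r_2+2s_2]$; (iii) $\sigma_{\delta}(T_0,\ell_p)=[r_1-2s_1,r_1+2s_1]\cup[r_2-2s_2,r_2+2s_2]$.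
   Context: $\ell_p$ is the complex Banach space of $p$-summable sequences $x=\{x_n\}_{n\ge 1}$. For $A\in B(X)$: $\sigma_{co}(A,X)=\{\lambda\in\mathbb{C}:\overline{R(A-\lambda I)}\ne X\}$; $\sigma_{app}(A,X)$ is the set of $\lambda\in\mathbb{C}$ for which there is a Weyl sequence for $A-\lambda I$, i.e. a sequence $(x^{(k)})$ in $X$ with $\|x^{(k)}\|=1$ and $\|(A-\lambda I)x^{(k)}\|\to0$; $\sigma_\delta(A,X)=\{\lambda\in\mathbb{C}: A-\lambda I\text{ is not surjective}\}$. Intervals $[a,b]$ are closed intervals of the real line, viewed as subsets of $\mathbb{C}$. *)

theory Defs
  imports "HOL-Analysis.Analysis"
begin

text \<open>
  Since \<open>p\<close> is a real parameter, the space of \<open>p\<close>-summable complex sequences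
  \<open>x = (x\<^sub>1, x\<^sub>2, \<dots>)\<close> is a carrier set rather than a type.
  Sequences are functions on \<open>nat\<close> whose genuine entries have index \<open>n \<ge> 1\<close>;
  the padding entry at index \<open>0\<close> is fixed to be \<open>0\<close>, so it does not contribute to the norm.
\<close>

definition lp :: "real \<Rightarrow> (nat \<Rightarrow> complex) set" where
  "lp p = {x. x 0 = 0 \<and> summable (\<lambda>n. cmod (x n) powr p)}"

definition lp_norm :: "real \<Rightarrow> (nat \<Rightarrow> complex) \<Rightarrow> real" where
  "lp_norm p x = (\<Sum>n. cmod (x n) powr p) powr (1 / p)"

definition lp_dist :: "real \<Rightarrow> (nat \<Rightarrow> complex) \<Rightarrow> (nat \<Rightarrow> complex) \<Rightarrow> real" where
  "lp_dist p x y = lp_norm p (\<lambda>n. x n - y n)"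

text \<open>For \<open>p \<ge> 1\<close> this is the norm topology; see \<open>Metric_space_lp\<close> below.\<close>

definition lp_topology :: "real \<Rightarrow> (nat \<Rightarrow> complex) topology" where
  "lp_topology p = Metric_space.mtopology (lp p) (lp_dist p)"

definition bounded_operator_lp ::
    "real \<Rightarrow> ((nat \<Rightarrow> complex) \<Rightarrow> (nat \<Rightarrow> complex)) \<Rightarrow> bool" where
  "bounded_operator_lp p A \<longleftrightarrow>
     (\<forall>x\<in>lp p. A x \<in> lp p) \<and>
     (\<forall>x\<in>lp p. \<forall>y\<in>lp p. A (\<lambda>n. x n + y n) = (\<lambda>n. A x n + A y n)) \<and>
     (\<forall>c. \<forall>x\<in>lp p. A (\<lambda>n. c * x n) = (\<lambda>n. c * A x n)) \<and>
     (\<exists>K. \<forall>x\<in>lp p. lp_norm p (A x) \<le> K * lp_norm p x)"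

definition minus_scalar ::
    "((nat \<Rightarrow> complex) \<Rightarrow> (nat \<Rightarrow> complex)) \<Rightarrow> complex \<Rightarrow> (nat \<Rightarrow> complex) \<Rightarrow> (nat \<Rightarrow> complex)" where
  "minus_scalar A \<mu> x = (\<lambda>n. A x n - \<mu> * x n)"

definition sigma_co :: "real \<Rightarrow> ((nat \<Rightarrow> complex) \<Rightarrow> (nat \<Rightarrow> complex)) \<Rightarrow> complex set" where
  "sigma_co p A = {\<mu>. lp_topology p closure_of (minus_scalar A \<mu> ` lp p) \<noteq> lp p}"

definition weyl_sequence ::
    "real \<Rightarrow> ((nat \<Rightarrow> complex) \<Rightarrow> (nat \<Rightarrow> complex)) \<Rightarrow> (nat \<Rightarrow> nat \<Rightarrow> complex) \<Rightarrow> bool" where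
  "weyl_sequence p B x \<longleftrightarrow>
     (\<forall>k. x k \<in> lp p \<and> lp_norm p (x k) = 1) \<and> (\<lambda>k. lp_norm p (B (x k))) \<longlonglongrightarrow> 0"

definition sigma_app :: "real \<Rightarrow> ((nat \<Rightarrow> complex) \<Rightarrow> (nat \<Rightarrow> complex)) \<Rightarrow> complex set" where
  "sigma_app p A = {\<mu>. \<exists>x. weyl_sequence p (minus_scalar A \<mu>) x}"

definition sigma_delta :: "real \<Rightarrow> ((nat \<Rightarrow> complex) \<Rightarrow> (nat \<Rightarrow> complex)) \<Rightarrow> complex set" where
  "sigma_delta p A = {\<mu>. minus_scalar A \<mu> ` lp p \<noteq> lp p}"

definition complex_interval :: "real \<Rightarrow> real \<Rightarrow> complex set" where
  "complex_interval a b = complex_of_real ` {a..b}"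

text \<open>
  For \<open>n = 1\<close> and \<open>n = 2\<close> truncated subtraction gives \<open>x (n - 2) = x 0\<close>, which is \<open>0\<close>
  on \<open>lp p\<close>: this is the convention \<open>x\<^sub>-\<^sub>1 = x\<^sub>0 = 0\<close>.
\<close>

definition T0 :: "real \<Rightarrow> real \<Rightarrow> real \<Rightarrow> real \<Rightarrow> (nat \<Rightarrow> complex) \<Rightarrow> (nat \<Rightarrow> complex)" where
  "T0 r1 r2 s1 s2 x = (\<lambda>n.
     if n = 0 then 0
     else if odd n then
       complex_of_real s1 * x (n - 2) + complex_of_real r1 * x n + complex_of_real s1 * x (n + 2)
     else
       complex_of_real s2 * x (n - 2) + complex_of_real r2 * x n + complex_of_real s2 * x (n + 2))"

lemma lp_norm_nonneg [simp]: "0 \<le> lp_norm p x"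
  by (simp add: lp_norm_def)

lemma lp_norm_powr:
  assumes "x \<in> lp p" "1 \<le> p"
  shows "lp_norm p x powr p = (\<Sum>n. cmod (x n) powr p)"
proof -
  have "0 \<le> (\<Sum>n. cmod (x n) powr p)"
    using assms by (intro suminf_nonneg) (auto simp: lp_def)
  then show ?thesis
    using assms by (simp add: lp_norm_def powr_powr)
qed

lemma lp_norm_eq_0_iff:
  assumes "x \<in> lp p" "1 \<le> p"
  shows "lp_norm p x = 0 \<longleftrightarrow> x = (\<lambda>n. 0)"
proof -
  have "lp_norm p x = 0 \<longleftrightarrow> (\<Sum>n. cmod (x n) powr p) = 0"
    by (simp add: lp_norm_def)
  also have "\<dots> \<longleftrightarrow> (\<forall>n. cmod (x n) powr p = 0)"
    using assms by (intro suminf_eq_zero_iff) (auto simp: lp_def)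
  finally show ?thesis by (auto simp: fun_eq_iff)
qed

lemma lp_zero: "(\<lambda>n. 0) \<in> lp p"
  by (simp add: lp_def)

lemma lp_bound:
  assumes x: "x \<in> lp p" and p: "1 \<le> p" and C: "0 \<le> C" and y0: "y 0 = 0"
    and y: "\<And>n. cmod (y n) powr p \<le> C powr p * f n"
    and f: "summable f" "suminf f \<le> (\<Sum>n. cmod (x n) powr p)"
  shows "y \<in> lp p" and "lp_norm p y \<le> C * lp_norm p x"
proof -
  have sm: "summable (\<lambda>n. C powr p * f n)"
    using f by (intro summable_mult)
  have sy: "summable (\<lambda>n. cmod (y n) powr p)"
    by (rule summable_comparison_test'[OF sm, of 0]) (use y in auto)
  show yl: "y \<in> lp p"
    using y0 sy by (simp add: lp_def)
  have "lp_norm p y powr p = (\<Sum>n. cmod (y n) powr p)"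
    using lp_norm_powr yl p by blast
  also have "\<dots> \<le> (\<Sum>n. C powr p * f n)"
    by (rule suminf_le[OF y sy sm])
  also have "\<dots> = C powr p * suminf f"
    using f by (simp add: suminf_mult)
  also have "\<dots> \<le> C powr p * lp_norm p x powr p"
    using f lp_norm_powr[OF x p] by (intro mult_left_mono) auto
  also have "\<dots> = (C * lp_norm p x) powr p"
    using C by (simp add: powr_mult)
  finally show "lp_norm p y \<le> C * lp_norm p x"
    using p C by (smt (verit) lp_norm_nonneg mult_nonneg_nonneg powr_less_mono2)
qed

lemma lp_mult_bounded:
  assumes x: "x \<in> lp p" and p: "1 \<le> p" and C: "0 \<le> C" and c: "\<And>n. cmod (c n) \<le> C"
  shows "(\<lambda>n. c n * x n) \<in> lp p" and "lp_norm p (\<lambda>n. c n * x n) \<le> C * lp_norm p x"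
proof -
  have y: "cmod (c n * x n) powr p \<le> C powr p * cmod (x n) powr p" for n
    using c[of n] C p by (auto simp: norm_mult powr_mult intro!: mult_right_mono powr_mono2)
  show "(\<lambda>n. c n * x n) \<in> lp p" "lp_norm p (\<lambda>n. c n * x n) \<le> C * lp_norm p x"
    using lp_bound[OF x p C _ y] x by (auto simp: lp_def)
qed

lemma lp_scale:
  assumes "x \<in> lp p" "1 \<le> p"
  shows "(\<lambda>n. c * x n) \<in> lp p"
  using lp_mult_bounded(1)[OF assms, of "cmod c" "\<lambda>_. c"] by simp

lemma powr_convex_combination:
  fixes t t' u v p :: real
  assumes p: "1 \<le> p" and t: "0 \<le> t" "0 \<le> t'" and uv: "0 \<le> u" "0 \<le> v" "u + v = 1"
  shows "(u * t + v * t') powr p \<le> u * t powr p + v * t' powr p"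
proof -
  have *: "(w * z) powr p \<le> w * z powr p" if "0 \<le> w" "w \<le> 1" "0 \<le> z" for w z :: real
  proof (cases "w = 0")
    case False
    then have "w powr p \<le> w powr 1"
      using that p by (intro powr_mono') auto
    then show ?thesis
      using that by (simp add: powr_mult mult_right_mono)
  qed auto
  consider "t = 0" | "t' = 0" | "0 < t" "0 < t'"
    using t by linarith
  then show ?thesis
  proof cases
    case 1
    then show ?thesis using *[of v t'] uv t by simp
  next
    case 2
    then show ?thesis using *[of u t] uv t by simp
  next
    case 3
    then show ?thesis
      using powr_convex[OF p] uv unfolding convex_on_def by simp
  qed
qed

lemma lp_add:
  assumes x: "x \<in> lp p" and y: "y \<in> lp p" and p: "1 \<le> p"
  shows "(\<lambda>n. x n + y n) \<in> lp p"
    and lp_norm_triangle: "lp_norm p (\<lambda>n. x n + y n) \<le> lp_norm p x + lp_norm p y"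
proof -
  define a b where "a = lp_norm p x" and "b = lp_norm p y"
  have "(\<lambda>n. x n + y n) \<in> lp p \<and> lp_norm p (\<lambda>n. x n + y n) \<le> a + b"
  proof (cases "a = 0 \<or> b = 0")
    case True
    then show ?thesis
    proof
      assume "a = 0"
      then have "x = (\<lambda>n. 0)" using lp_norm_eq_0_iff[OF x p] a_def by simp
      then show ?thesis using y \<open>a = 0\<close> b_def by simp
    next
      assume "b = 0"
      then have "y = (\<lambda>n. 0)" using lp_norm_eq_0_iff[OF y p] b_def by simp
      then show ?thesis using x \<open>b = 0\<close> a_def by simp
    qed
  next
    case False
    then have ab: "a > 0" "b > 0"
      using lp_norm_nonneg[of p x] lp_norm_nonneg[of p y] unfolding a_def b_def by linarith+
    have sx: "summable (\<lambda>n. cmod (x n) powr p)" and sy: "summable (\<lambda>n. cmod (y n) powr p)"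
      using x y by (auto simp: lp_def)
    have xs: "(\<Sum>n. cmod (x n) powr p) = a powr p" and ys: "(\<Sum>n. cmod (y n) powr p) = b powr p"
      using lp_norm_powr x y p a_def b_def by auto
    define u where "u = a / (a + b)"
    define v where "v = b / (a + b)"
    have uv: "u \<ge> 0" "v \<ge> 0" "u + v = 1"
      using ab by (auto simp: u_def v_def add_divide_distrib[symmetric])
    define f where "f n = u * (cmod (x n) powr p / a powr p) + v * (cmod (y n) powr p / b powr p)" for n
    have fsums: "f sums (u * (a powr p / a powr p) + v * (b powr p / b powr p))"
      unfolding f_def using summable_sums[OF sx] summable_sums[OF sy] xs ys
      by (intro sums_add sums_mult sums_divide) auto
    then have f1: "f sums 1"
      using ab uv by simp
    have bd: "cmod (x n + y n) powr p \<le> (a + b) powr p * f n" for n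
    proof -
      have "cmod (x n + y n) \<le> cmod (x n) + cmod (y n)"
        by (rule norm_triangle_ineq)
      also have "\<dots> = (a + b) * (u * (cmod (x n) / a) + v * (cmod (y n) / b))"
      proof -
        have "(a + b) * u = a" "(a + b) * v = b"
          using ab by (auto simp: u_def v_def)
        then have "(a + b) * (u * (cmod (x n) / a) + v * (cmod (y n) / b))
            = a * (cmod (x n) / a) + b * (cmod (y n) / b)"
          by (simp only: distrib_left mult.assoc[symmetric])
        then show ?thesis using ab by simp
      qed
      finally have "cmod (x n + y n) powr p
          \<le> ((a + b) * (u * (cmod (x n) / a) + v * (cmod (y n) / b))) powr p"
        using p by (intro powr_mono2) auto
      also have "\<dots> = (a + b) powr p * (u * (cmod (x n) / a) + v * (cmod (y n) / b)) powr p"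
        using ab uv by (intro powr_mult)
      also have "(u * (cmod (x n) / a) + v * (cmod (y n) / b)) powr p
          \<le> u * (cmod (x n) / a) powr p + v * (cmod (y n) / b) powr p"
        using uv ab p by (intro powr_convex_combination) auto
      also have "u * (cmod (x n) / a) powr p + v * (cmod (y n) / b) powr p = f n"
        using ab by (simp add: f_def powr_divide)
      finally show ?thesis by (simp add: mult_left_mono)
    qed
    have sm: "summable (\<lambda>n. (a + b) powr p * f n)"
      using f1 by (intro summable_mult) (auto simp: sums_iff)
    have sxy: "summable (\<lambda>n. cmod (x n + y n) powr p)"
      by (rule summable_comparison_test'[OF sm, of 0]) (use bd in auto)
    have l: "(\<lambda>n. x n + y n) \<in> lp p"
      using sxy x y by (auto simp: lp_def)
    have "lp_norm p (\<lambda>n. x n + y n) powr p = (\<Sum>n. cmod (x n + y n) powr p)"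
      using lp_norm_powr[OF l p] .
    also have "\<dots> \<le> (\<Sum>n. (a + b) powr p * f n)"
      by (rule suminf_le[OF bd sxy sm])
    also have "\<dots> = (a + b) powr p"
      using f1 by (simp add: suminf_mult sums_iff)
    finally have "lp_norm p (\<lambda>n. x n + y n) \<le> a + b"
      using p ab by (smt (verit) lp_norm_nonneg powr_less_mono2)
    with l show ?thesis by blast
  qed
  then show "(\<lambda>n. x n + y n) \<in> lp p" "lp_norm p (\<lambda>n. x n + y n) \<le> lp_norm p x + lp_norm p y"
    by (auto simp: a_def b_def)
qed

lemma lp_diff:
  assumes x: "x \<in> lp p" and y: "y \<in> lp p" and p: "1 \<le> p"
  shows "(\<lambda>n. x n - y n) \<in> lp p"
  using lp_add(1)[OF x lp_scale[OF y p, of "-1"] p] by simp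

lemma Metric_space_lp:
  assumes p: "1 \<le> p"
  shows "Metric_space (lp p) (lp_dist p)"
proof
  fix x y :: "nat \<Rightarrow> complex"
  show "0 \<le> lp_dist p x y"
    by (simp add: lp_dist_def)
  show "lp_dist p x y = lp_dist p y x"
    by (simp add: lp_dist_def lp_norm_def norm_minus_commute)
next
  fix x y :: "nat \<Rightarrow> complex"
  assume "x \<in> lp p" "y \<in> lp p"
  then show "lp_dist p x y = 0 \<longleftrightarrow> x = y"
    using lp_norm_eq_0_iff[OF lp_diff p] p by (auto simp: lp_dist_def fun_eq_iff)
next
  fix x y z :: "nat \<Rightarrow> complex"
  assume "x \<in> lp p" "y \<in> lp p" "z \<in> lp p"
  then show "lp_dist p x z \<le> lp_dist p x y + lp_dist p y z"
    using lp_norm_triangle[of "\<lambda>n. x n - y n" p "\<lambda>n. y n - z n"] lp_diff p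
    by (simp add: lp_dist_def)
qed

lemma lp_shift_right:
  assumes x: "x \<in> lp p" and p: "1 \<le> p"
  shows "(\<lambda>n. x (n - 2)) \<in> lp p" and "lp_norm p (\<lambda>n. x (n - 2)) \<le> 1 * lp_norm p x"
proof -
  define f where "f n = cmod (x (n - 2)) powr p" for n
  have sx: "(\<lambda>n. cmod (x n) powr p) sums (\<Sum>n. cmod (x n) powr p)"
    using x by (auto simp: lp_def intro: summable_sums)
  have "(\<lambda>n. f (n + 2)) sums (\<Sum>n. cmod (x n) powr p)"
    using sx by (simp add: f_def)
  moreover have "(\<Sum>i<2. f i) = 0"
    using x by (simp add: f_def lp_def numeral_2_eq_2)
  ultimately have fs: "f sums (\<Sum>n. cmod (x n) powr p)"
    using sums_iff_shift[of f 2] by simp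
  have y: "cmod (x (n - 2)) powr p \<le> 1 powr p * f n" for n
    by (simp add: f_def)
  show "(\<lambda>n. x (n - 2)) \<in> lp p" "lp_norm p (\<lambda>n. x (n - 2)) \<le> 1 * lp_norm p x"
    using lp_bound[OF x p zero_le_one _ y] x fs by (auto simp: lp_def sums_iff)
qed

lemma lp_shift_left:
  assumes x: "x \<in> lp p" and p: "1 \<le> p"
  shows "(\<lambda>n. if n = 0 then 0 else x (n + 2)) \<in> lp p"
    and "lp_norm p (\<lambda>n. if n = 0 then 0 else x (n + 2)) \<le> 1 * lp_norm p x"
proof -
  define f where "f n = cmod (x (n + 2)) powr p" for n
  have sx: "summable (\<lambda>n. cmod (x n) powr p)"
    using x by (auto simp: lp_def)
  then have sf: "summable f"
    unfolding f_def by (subst summable_iff_shift)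
  have "suminf f \<le> (\<Sum>n. cmod (x n) powr p)"
    unfolding f_def using suminf_split_initial_segment[OF sx, of 2] by (simp add: sum_nonneg)
  moreover have y: "cmod (if n = 0 then 0 else x (n + 2)) powr p \<le> 1 powr p * f n" for n
    by (simp add: f_def)
  ultimately show "(\<lambda>n. if n = 0 then 0 else x (n + 2)) \<in> lp p"
    "lp_norm p (\<lambda>n. if n = 0 then 0 else x (n + 2)) \<le> 1 * lp_norm p x"
    using lp_bound[OF x p zero_le_one _ y] sf by auto
qed

lemma bounded_operator_T0:
  assumes p: "1 \<le> p"
  shows "bounded_operator_lp p (T0 r1 r2 s1 s2)"
proof -
  define s where "s n = complex_of_real (if odd n then s1 else s2)" for n :: nat
  define r where "r n = complex_of_real (if odd n then r1 else r2)" for n :: nat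
  define S where "S = \<bar>s1\<bar> + \<bar>s2\<bar>"
  define R where "R = \<bar>r1\<bar> + \<bar>r2\<bar>"
  have S0: "0 \<le> S" and R0: "0 \<le> R" and s: "\<And>n. cmod (s n) \<le> S" and r: "\<And>n. cmod (r n) \<le> R"
    by (auto simp: s_def r_def S_def R_def)
  have main: "T0 r1 r2 s1 s2 x \<in> lp p \<and> lp_norm p (T0 r1 r2 s1 s2 x) \<le> (2 * S + R) * lp_norm p x"
    if x: "x \<in> lp p" for x
  proof -
    define y1 where "y1 n = s n * x (n - 2)" for n
    define y2 where "y2 n = r n * x n" for n
    define y3 where "y3 n = s n * (if n = 0 then 0 else x (n + 2))" for n
    have y1: "y1 \<in> lp p" "lp_norm p y1 \<le> S * lp_norm p x"
      unfolding y1_def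
      using lp_mult_bounded[where c = s, OF lp_shift_right(1)[OF x p] p S0 s]
        mult_left_mono[OF lp_shift_right(2)[OF x p] S0] by (simp_all only: mult_1)
    have y2: "y2 \<in> lp p" "lp_norm p y2 \<le> R * lp_norm p x"
      using lp_mult_bounded[OF x p R0 r] unfolding y2_def by auto
    have y3: "y3 \<in> lp p" "lp_norm p y3 \<le> S * lp_norm p x"
      unfolding y3_def
      using lp_mult_bounded[where c = s, OF lp_shift_left(1)[OF x p] p S0 s]
        mult_left_mono[OF lp_shift_left(2)[OF x p] S0] by (simp_all only: mult_1)
    have eq: "T0 r1 r2 s1 s2 x = (\<lambda>n. (y1 n + y2 n) + y3 n)"
      using x by (auto simp: T0_def y1_def y2_def y3_def s_def r_def lp_def fun_eq_iff)
    show ?thesis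
      unfolding eq
      using lp_add[OF y1(1) y2(1) p] lp_add[OF lp_add(1)[OF y1(1) y2(1) p] y3(1) p] y1(2) y2(2) y3(2)
      by (auto simp: algebra_simps)
  qed
  then show ?thesis
    unfolding bounded_operator_lp_def
    by (intro conjI exI[of _ "2 * S + R"]) (auto simp: T0_def fun_eq_iff algebra_simps)
qed

end

theory Submission
  imports Defs
begin

text \<open>
  For a complex number \<open>\<mu>\<close> write \<open>\<mu> = r + s (\<zeta> + 1 / \<zeta>)\<close> with \<open>0 < \<bar>\<zeta>\<bar> \<le> 1\<close>, separately for the odd
  and the even entries; then \<open>\<bar>\<zeta>\<bar> = 1\<close> exactly if \<open>\<mu>\<close> lies in \<open>[r - 2s, r + 2s]\<close>. If \<open>L\<close> and \<open>R\<close> are the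
  left and right shifts by two places and \<open>\<zeta>\<close> acts diagonally, then
  \<open>T\<^sub>0 - \<mu> = - (s / \<zeta>) (\<zeta> L - 1) (\<zeta> R - 1)\<close>.
  If \<open>\<bar>\<zeta>\<bar> < 1\<close> for both parities, the two factors are contractions minus the identity, hence
  bijective with bounded inverse. The range of both factors is always dense: the left factor attains
  every finite sequence, and Cesaro means of the geometric series solve the right one approximately.
  If \<open>\<bar>\<zeta>\<bar> = 1\<close> for some parity, normalised geometric blocks \<open>\<zeta>\<^sup>j\<close>, \<open>j \<le> N\<close>, form a Weyl
  sequence of the right factor, and divergence of the harmonic series shows that the left factor is
  not surjective.
\<close>

section \<open>Norm estimates and completeness of the sequence space \<open>lp p\<close>\<close>

lemma lp_norm_uminus: "lp_norm p (\<lambda>n. - x n) = lp_norm p x"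
  by (simp add: lp_norm_def)

lemma lp_norm_minus_commute: "lp_norm p (\<lambda>n. x n - y n) = lp_norm p (\<lambda>n. y n - x n)"
  by (simp add: lp_norm_def norm_minus_commute)

lemma lp_norm_zero: "lp_norm p (\<lambda>n. 0) = 0"
  by (simp add: lp_norm_def)

lemma lp_norm_triangle_diff:
  assumes "x \<in> lp p" "y \<in> lp p" "1 \<le> p"
  shows "lp_norm p (\<lambda>n. x n - y n) \<le> lp_norm p x + lp_norm p y"
  using lp_norm_triangle[OF assms(1) lp_scale[OF assms(2,3), of "-1"] assms(3)]
  by (simp add: lp_norm_uminus)

lemma lp_norm_triangle_via:
  assumes "x \<in> lp p" "y \<in> lp p" "z \<in> lp p" "1 \<le> p"
  shows "lp_norm p (\<lambda>n. x n - z n) \<le> lp_norm p (\<lambda>n. x n - y n) + lp_norm p (\<lambda>n. y n - z n)"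
  using lp_norm_triangle[OF lp_diff[OF assms(1,2,4)] lp_diff[OF assms(2,3,4)] assms(4)] by simp

lemma norm_component_le_lp_norm:
  assumes x: "x \<in> lp p" and p: "1 \<le> p"
  shows "cmod (x n) \<le> lp_norm p x"
proof -
  have "summable (\<lambda>n. cmod (x n) powr p)"
    using x by (simp add: lp_def)
  then have "sum (\<lambda>n. cmod (x n) powr p) {n} \<le> (\<Sum>n. cmod (x n) powr p)"
    by (intro sum_le_suminf) auto
  then have "cmod (x n) powr p \<le> lp_norm p x powr p"
    using lp_norm_powr[OF x p] by simp
  then show ?thesis
    using p by (smt (verit) lp_norm_nonneg norm_ge_zero powr_less_mono2)
qed

lemma lp_finite_support:
  assumes "finite S" and "\<And>n. n \<notin> S \<Longrightarrow> x n = 0" and "0 \<notin> S" and p: "1 \<le> p"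
  shows "x \<in> lp p" and "lp_norm p x = (\<Sum>n\<in>S. cmod (x n) powr p) powr (1 / p)"
proof -
  have "(\<lambda>n. cmod (x n) powr p) sums (\<Sum>n\<in>S. cmod (x n) powr p)"
    by (rule sums_finite) (use assms in auto)
  then show "x \<in> lp p" "lp_norm p x = (\<Sum>n\<in>S. cmod (x n) powr p) powr (1 / p)"
    using assms by (auto simp: lp_def lp_norm_def sums_iff)
qed

lemma lp_norm_le_of_partial_sums:
  assumes p: "1 \<le> p" and C: "0 \<le> C" and x0: "x 0 = 0"
    and le: "\<And>N. (\<Sum>n<N. cmod (x n) powr p) \<le> C powr p"
  shows "x \<in> lp p" and "lp_norm p x \<le> C"
proof -
  have s: "summable (\<lambda>n. cmod (x n) powr p)"
    by (rule summableI_nonneg_bounded[OF _ le]) simp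
  then show "x \<in> lp p"
    using x0 by (simp add: lp_def)
  have "lp_norm p x \<le> (C powr p) powr (1 / p)"
    unfolding lp_norm_def using p s le
    by (intro powr_mono2 suminf_le_const suminf_nonneg) auto
  then show "lp_norm p x \<le> C"
    using p C by (simp add: powr_powr)
qed

text \<open>A Fatou-type argument: a finite partial sum of p-th powers passes to the coordinatewise
  limit, and its bound \<open>C powr p\<close> does not depend on the number of terms.\<close>

lemma lp_pointwise_limit:
  assumes p: "1 \<le> p" and X: "\<And>k. X k \<in> lp p" and C: "\<And>k. lp_norm p (X k) \<le> C"
    and lim: "\<And>n. (\<lambda>k. X k n) \<longlonglongrightarrow> x n"
  shows "x \<in> lp p" and "lp_norm p x \<le> C"
proof -
  have C0: "0 \<le> C"
    using C[of 0] lp_norm_nonneg[of p "X 0"] by linarith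
  have "(\<lambda>k. X k 0) = (\<lambda>k. 0)"
    using X by (simp add: lp_def)
  then have x0: "x 0 = 0"
    using lim[of 0] by (simp add: LIMSEQ_const_iff)
  have "(\<Sum>n<N. cmod (x n) powr p) \<le> C powr p" for N
  proof (rule LIMSEQ_le_const2)
    show "(\<lambda>k. \<Sum>n<N. cmod (X k n) powr p) \<longlonglongrightarrow> (\<Sum>n<N. cmod (x n) powr p)"
      using p by (intro tendsto_intros tendsto_powr2 lim) auto
    have "(\<Sum>n<N. cmod (X k n) powr p) \<le> C powr p" for k
    proof -
      have "(\<Sum>n<N. cmod (X k n) powr p) \<le> (\<Sum>n. cmod (X k n) powr p)"
        using X[of k] by (intro sum_le_suminf) (auto simp: lp_def)
      also have "\<dots> = lp_norm p (X k) powr p"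
        using lp_norm_powr[OF X p] by simp
      also have "\<dots> \<le> C powr p"
        using C p by (intro powr_mono2) auto
      finally show ?thesis .
    qed
    then show "\<exists>N'. \<forall>k\<ge>N'. (\<Sum>n<N. cmod (X k n) powr p) \<le> C powr p"
      by blast
  qed
  then show "x \<in> lp p" "lp_norm p x \<le> C"
    using lp_norm_le_of_partial_sums[of p C x] p C0 x0 by auto
qed

text \<open>The coordinates are Cauchy, so a coordinatewise limit exists. Norm convergence follows
  from \<open>lp_pointwise_limit\<close>, applied to tails of the differences
  \<open>X m - X n\<close> with \<open>n\<close> fixed.\<close>

lemma lp_complete:
  assumes p: "1 \<le> p" and X: "\<And>k. X k \<in> lp p"
    and Cauchy: "\<And>e. 0 < e \<Longrightarrow> \<exists>N. \<forall>m\<ge>N. \<forall>n\<ge>N. lp_norm p (\<lambda>i. X m i - X n i) < e"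
  obtains x where "x \<in> lp p" and "(\<lambda>k. lp_norm p (\<lambda>i. X k i - x i)) \<longlonglongrightarrow> 0"
proof -
  have "Cauchy (\<lambda>k. X k i)" for i
  proof (rule metric_CauchyI)
    fix e :: real
    assume "0 < e"
    then obtain N where N: "\<forall>m\<ge>N. \<forall>n\<ge>N. lp_norm p (\<lambda>i. X m i - X n i) < e"
      using Cauchy by blast
    have "dist (X m i) (X n i) \<le> lp_norm p (\<lambda>i. X m i - X n i)" for m n
      using norm_component_le_lp_norm[OF lp_diff[OF X[of m] X[of n] p] p, of i] by (simp add: dist_norm)
    then show "\<exists>M. \<forall>m\<ge>M. \<forall>n\<ge>M. dist (X m i) (X n i) < e"
      using N by (intro exI[of _ N]) (meson le_less_trans)
  qed
  then have "\<forall>i. \<exists>l. (\<lambda>k. X k i) \<longlonglongrightarrow> l"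
    using Cauchy_convergent_iff convergent_def by blast
  then obtain x where lim: "\<And>i. (\<lambda>k. X k i) \<longlonglongrightarrow> x i"
    by metis
  have near: "(\<lambda>i. x i - X n i) \<in> lp p \<and> lp_norm p (\<lambda>i. x i - X n i) \<le> e"
    if N: "\<forall>m\<ge>N. lp_norm p (\<lambda>i. X m i - X n i) < e" for n N e
  proof -
    have "(\<lambda>k. X (k + N) i - X n i) \<longlonglongrightarrow> x i - X n i" for i
      by (intro tendsto_intros LIMSEQ_ignore_initial_segment lim)
    moreover have "lp_norm p (\<lambda>i. X (k + N) i - X n i) \<le> e" for k
      using N by (simp add: less_imp_le)
    moreover have "(\<lambda>i. X (k + N) i - X n i) \<in> lp p" for k
      using lp_diff[OF X X p] .
    ultimately show ?thesis
      using lp_pointwise_limit[of p "\<lambda>k i. X (k + N) i - X n i" e "\<lambda>i. x i - X n i"] p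
      by simp
  qed
  obtain N where "\<forall>m\<ge>N. \<forall>n\<ge>N. lp_norm p (\<lambda>i. X m i - X n i) < 1"
    using Cauchy[of 1] by auto
  then have "(\<lambda>i. x i - X N i) \<in> lp p"
    using near by blast
  from lp_add(1)[OF this X[of N] p] have "x \<in> lp p"
    by simp
  moreover have "(\<lambda>k. lp_norm p (\<lambda>i. X k i - x i)) \<longlonglongrightarrow> 0"
  proof (rule metric_LIMSEQ_I)
    fix e :: real
    assume "0 < e"
    then obtain N where N: "\<forall>m\<ge>N. \<forall>n\<ge>N. lp_norm p (\<lambda>i. X m i - X n i) < e / 2"
      using Cauchy[of "e / 2"] by auto
    have "lp_norm p (\<lambda>i. X n i - x i) < e" if "n \<ge> N" for n
    proof -
      have "lp_norm p (\<lambda>i. x i - X n i) \<le> e / 2"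
        using near[of N n "e / 2"] N that by simp
      then show ?thesis
        using \<open>0 < e\<close> lp_norm_minus_commute[of p x "X n"] by simp
    qed
    then show "\<exists>N. \<forall>n\<ge>N. dist (lp_norm p (\<lambda>i. X n i - x i)) 0 < e"
      by auto
  qed
  ultimately show ?thesis
    using that by blast
qed

section \<open>Bounded operators and inversion of a contraction minus the identity\<close>

text \<open>\<open>C\<close> is some bound, not necessarily the least one. Compatibility with
  differences turns it into a Lipschitz constant, the form in which linearity enters the estimates
  below.\<close>

definition lp_operator :: "real \<Rightarrow> real \<Rightarrow> ((nat \<Rightarrow> complex) \<Rightarrow> (nat \<Rightarrow> complex)) \<Rightarrow> bool" where
  "lp_operator p C f \<longleftrightarrow>
     (\<forall>x\<in>lp p. f x \<in> lp p \<and> lp_norm p (f x) \<le> C * lp_norm p x) \<and>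
     (\<forall>x\<in>lp p. \<forall>y\<in>lp p. f (\<lambda>n. x n - y n) = (\<lambda>n. f x n - f y n))"

lemma lp_operatorD:
  assumes "lp_operator p C f" "x \<in> lp p"
  shows "f x \<in> lp p" "lp_norm p (f x) \<le> C * lp_norm p x"
    "y \<in> lp p \<Longrightarrow> f (\<lambda>n. x n - y n) = (\<lambda>n. f x n - f y n)"
  using assms by (auto simp: lp_operator_def)

lemma lp_operator_zero:
  assumes "lp_operator p C f"
  shows "f (\<lambda>n. 0) = (\<lambda>n. 0)"
  using lp_operatorD(3)[OF assms lp_zero lp_zero] by simp

lemma lp_operator_compose:
  assumes f: "lp_operator p C f" and g: "lp_operator p D g" and "0 \<le> C"
  shows "lp_operator p (C * D) (\<lambda>x. f (g x))"
proof -
  have "lp_norm p (f (g x)) \<le> C * D * lp_norm p x" if "x \<in> lp p" for x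
    using lp_operatorD(2)[OF f lp_operatorD(1)[OF g that]]
      mult_left_mono[OF lp_operatorD(2)[OF g that] \<open>0 \<le> C\<close>] by (simp add: mult.assoc)
  then show ?thesis
    unfolding lp_operator_def by (simp add: lp_operatorD(1,3)[OF f] lp_operatorD(1,3)[OF g])
qed

lemma lp_operator_minus_1:
  assumes f: "lp_operator p C f" and p: "1 \<le> p"
  shows "lp_operator p (C + 1) (minus_scalar f 1)"
proof -
  have "lp_norm p (minus_scalar f 1 x) \<le> (C + 1) * lp_norm p x" if "x \<in> lp p" for x
    using lp_norm_triangle_diff[OF lp_operatorD(1)[OF f that] that p] lp_operatorD(2)[OF f that]
    by (simp add: minus_scalar_def distrib_right)
  then show ?thesis
    unfolding lp_operator_def
    by (simp add: minus_scalar_def lp_operatorD(1,3)[OF f] lp_diff p fun_eq_iff)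
qed

text \<open>The triangle inequality for \<open>x = f x - (f x - x)\<close>. For \<open>q < 1\<close>
  it excludes Weyl sequences of \<open>f - 1\<close>.\<close>

lemma contraction_minus_1_bounded_below:
  assumes f: "lp_operator p q f" and p: "1 \<le> p" and x: "x \<in> lp p"
  shows "(1 - q) * lp_norm p x \<le> lp_norm p (minus_scalar f 1 x)"
proof -
  have fx: "f x \<in> lp p"
    using f x by (rule lp_operatorD)
  have "lp_norm p x \<le> lp_norm p (f x) + lp_norm p (\<lambda>n. f x n - x n)"
    using lp_norm_triangle_diff[OF fx lp_diff[OF fx x p] p] by simp
  then show ?thesis
    using lp_operatorD(2)[OF f x] by (simp add: minus_scalar_def algebra_simps)
qed

text \<open>Solving \<open>f x - x = y\<close> means finding a fixed point of
  \<open>g x = f x - y\<close>, a contraction of a complete space. The iterates of \<open>g\<close>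
  from 0 are, up to sign, the partial sums of the Neumann series.\<close>

lemma contraction_minus_1_surj:
  assumes f: "lp_operator p q f" and q: "0 \<le> q" "q < 1" and p: "1 \<le> p"
  shows "minus_scalar f 1 ` lp p = lp p"
proof
  show "minus_scalar f 1 ` lp p \<subseteq> lp p"
    using lp_operatorD(1)[OF lp_operator_minus_1[OF f p]] by blast
  show "lp p \<subseteq> minus_scalar f 1 ` lp p"
  proof
    fix y
    assume y: "y \<in> lp p"
    define g where "g x = (\<lambda>n. f x n - y n)" for x
    define u where "u k = (g ^^ k) (\<lambda>n. 0)" for k
    have g: "g x \<in> lp p" if "x \<in> lp p" for x
      unfolding g_def using lp_diff[OF lp_operatorD(1)[OF f that] y p] .
    have u: "u k \<in> lp p" for k
      by (induction k) (auto simp: u_def lp_zero g)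
    have u_Suc: "u (Suc k) = g (u k)" for k
      by (simp add: u_def)
    have g_lip: "lp_norm p (\<lambda>n. g a n - g b n) \<le> q * lp_norm p (\<lambda>n. a n - b n)"
      if "a \<in> lp p" "b \<in> lp p" for a b
      using lp_operatorD(2)[OF f lp_diff[OF that p]] lp_operatorD(3)[OF f that]
      by (simp add: g_def)
    \<comment> \<open>\<open>B\<close> is the fixed point of the map taking \<open>t\<close> to
      \<open>q * t + lp_norm p y\<close>, so a bound by \<open>B\<close> is inherited by the next
      iterate.\<close>
    define B where "B = lp_norm p y / (1 - q)"
    have B: "q * B + lp_norm p y = B"
      using q by (simp add: B_def field_simps)
    have u_le: "lp_norm p (u k) \<le> B" for k
    proof (induction k)
      case 0
      show ?case
        using q by (simp add: u_def lp_norm_zero B_def)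
    next
      case (Suc k)
      have "lp_norm p (u (Suc k)) \<le> q * lp_norm p (u k) + lp_norm p y"
        using lp_norm_triangle_diff[OF lp_operatorD(1)[OF f u[of k]] y p] lp_operatorD(2)[OF f u[of k]]
        unfolding u_Suc g_def by linarith
      also have "\<dots> \<le> q * B + lp_norm p y"
        using Suc q by (simp add: mult_left_mono)
      finally show ?case
        using B by simp
    qed
    \<comment> \<open>For \<open>k = 0\<close> the difference is \<open>u d\<close>, bounded by
      \<open>B\<close>, because \<open>u 0 = 0\<close>; each further application of \<open>g\<close>
      contributes a factor \<open>q\<close>.\<close>
    have u_diff: "lp_norm p (\<lambda>n. u (k + d) n - u k n) \<le> q ^ k * B" for k d
    proof (induction k)
      case 0
      show ?case
        using u_le by (simp add: u_def)
    next
      case (Suc k)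
      have "lp_norm p (\<lambda>n. u (Suc k + d) n - u (Suc k) n) \<le> q * lp_norm p (\<lambda>n. u (k + d) n - u k n)"
        using g_lip[OF u u] by (simp add: u_Suc)
      also have "\<dots> \<le> q * (q ^ k * B)"
        using Suc q by (intro mult_left_mono) auto
      finally show ?case
        by (simp add: mult.assoc)
    qed
    have "(\<lambda>k. q ^ k * B) \<longlonglongrightarrow> 0"
      using q by (intro tendsto_mult_left_zero LIMSEQ_power_zero) auto
    then have Cauchy: "\<exists>N. \<forall>m\<ge>N. \<forall>n\<ge>N. lp_norm p (\<lambda>i. u m i - u n i) < e" if e: "0 < e" for e
    proof -
      obtain N where N: "\<And>k. k \<ge> N \<Longrightarrow> q ^ k * B < e"
        using order_tendstoD(2)[OF \<open>(\<lambda>k. q ^ k * B) \<longlonglongrightarrow> 0\<close> e]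
        by (auto simp: eventually_sequentially)
      have *: "lp_norm p (\<lambda>i. u m i - u n i) < e" if "n \<ge> N" "m \<ge> n" for m n
        using u_diff[of n "m - n"] N[OF that(1)] that by simp
      have "lp_norm p (\<lambda>i. u m i - u n i) < e" if "n \<ge> N" "m \<ge> N" for m n
        using *[of n m] *[of m n] that lp_norm_minus_commute[of p "u m" "u n"]
        by (cases "m \<ge> n") auto
      then show ?thesis
        by blast
    qed
    obtain x where x: "x \<in> lp p" and lim: "(\<lambda>k. lp_norm p (\<lambda>i. u k i - x i)) \<longlonglongrightarrow> 0"
      using lp_complete[of p u, OF p u Cauchy] by blast
    \<comment> \<open>The residual of the fixed point equation is split at the iterate
      \<open>u (Suc k) = g (u k)\<close>, which is close to both \<open>x\<close> and
      \<open>g x\<close>.\<close>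
    have le: "lp_norm p (\<lambda>i. x i - g x i)
        \<le> lp_norm p (\<lambda>i. u (Suc k) i - x i) + q * lp_norm p (\<lambda>i. u k i - x i)" for k
      using lp_norm_triangle_via[OF x u g[OF x] p, of "Suc k"] g_lip[OF u x, of k]
        lp_norm_minus_commute[of p x "u (Suc k)"] by (simp add: u_Suc)
    have "(\<lambda>k. lp_norm p (\<lambda>i. u (Suc k) i - x i) + q * lp_norm p (\<lambda>i. u k i - x i)) \<longlonglongrightarrow> 0 + q * 0"
      by (intro tendsto_intros lim LIMSEQ_Suc[OF lim])
    then have "lp_norm p (\<lambda>i. x i - g x i) \<le> 0"
      using le LIMSEQ_le_const by fastforce
    then have "lp_norm p (\<lambda>i. x i - g x i) = 0"
      using lp_norm_nonneg order_antisym by blast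
    then have "(\<lambda>i. x i - g x i) = (\<lambda>i. 0)"
      using lp_norm_eq_0_iff[OF lp_diff[OF x g[OF x] p] p] by simp
    then have "minus_scalar f 1 x = y"
      by (auto simp: minus_scalar_def g_def fun_eq_iff algebra_simps)
    then show "y \<in> minus_scalar f 1 ` lp p"
      using x by blast
  qed
qed

section \<open>Operators with dense range\<close>

text \<open>The metric form of density; \<open>lp_dense_range_closure\<close> translates it into a
  statement about the closure in \<open>lp_topology p\<close>.\<close>

definition lp_dense_range :: "real \<Rightarrow> ((nat \<Rightarrow> complex) \<Rightarrow> (nat \<Rightarrow> complex)) \<Rightarrow> bool" where
  "lp_dense_range p f \<longleftrightarrow> (\<forall>y\<in>lp p. \<forall>e>0. \<exists>x\<in>lp p. lp_norm p (\<lambda>n. y n - f x n) < e)"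

lemma lp_dense_range_surj:
  assumes "f ` lp p = lp p"
  shows "lp_dense_range p f"
  unfolding lp_dense_range_def
proof (intro ballI allI impI)
  fix y and e :: real
  assume y: "y \<in> lp p" and "0 < e"
  have "y \<in> f ` lp p"
    using y by (simp only: assms)
  then obtain x where "x \<in> lp p" "y = f x"
    by blast
  then show "\<exists>x\<in>lp p. lp_norm p (\<lambda>n. y n - f x n) < e"
    using \<open>0 < e\<close> by (intro bexI[of _ x]) (auto simp: lp_norm_zero)
qed

text \<open>Approximate \<open>y\<close> by \<open>f u\<close> and then \<open>u\<close> by
  \<open>g x\<close>. The second error grows at most by the factor \<open>C\<close> under
  \<open>f\<close>, whence the tolerance \<open>e / (2 * C)\<close>.\<close>

lemma lp_dense_range_compose:
  assumes f: "lp_operator p C f" and g: "lp_operator p D g" and C: "0 < C" and p: "1 \<le> p"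
    and df: "lp_dense_range p f" and dg: "lp_dense_range p g"
  shows "lp_dense_range p (\<lambda>x. f (g x))"
  unfolding lp_dense_range_def
proof (intro ballI allI impI)
  fix y and e :: real
  assume y: "y \<in> lp p" and e: "0 < e"
  obtain u where u: "u \<in> lp p" "lp_norm p (\<lambda>n. y n - f u n) < e / 2"
    using df y e half_gt_zero unfolding lp_dense_range_def by blast
  have "0 < e / (2 * C)"
    using e C by simp
  then obtain x where x: "x \<in> lp p" "lp_norm p (\<lambda>n. u n - g x n) < e / (2 * C)"
    using dg u(1) unfolding lp_dense_range_def by blast
  note gx = lp_operatorD(1)[OF g x(1)]
  have "lp_norm p (\<lambda>n. f u n - f (g x) n) \<le> C * lp_norm p (\<lambda>n. u n - g x n)"
    using lp_operatorD(2)[OF f lp_diff[OF u(1) gx p]] lp_operatorD(3)[OF f u(1) gx] by simp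
  also have "\<dots> < C * (e / (2 * C))"
    using x(2) C by (rule mult_strict_left_mono)
  finally have "lp_norm p (\<lambda>n. f u n - f (g x) n) < e / 2"
    using C by simp
  then have "lp_norm p (\<lambda>n. y n - f (g x) n) < e"
    using lp_norm_triangle_via[OF y lp_operatorD(1)[OF f u(1)] lp_operatorD(1)[OF f gx] p] u(2)
    by simp
  then show "\<exists>x\<in>lp p. lp_norm p (\<lambda>n. y n - f (g x) n) < e"
    using x(1) by blast
qed

text \<open>The norm of the remainder is the p-th root of a tail of a convergent series.\<close>

lemma lp_truncation_tendsto:
  assumes x: "x \<in> lp p" and p: "1 \<le> p"
  shows "(\<lambda>N. lp_norm p (\<lambda>n. x n - (if n < N then x n else 0))) \<longlonglongrightarrow> 0"
proof -
  have s: "summable (\<lambda>n. cmod (x n) powr p)"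
    using x by (simp add: lp_def)
  have "(\<Sum>n. cmod (x n - (if n < N then x n else 0)) powr p) = (\<Sum>n. cmod (x (n + N)) powr p)" for N
  proof -
    let ?f = "\<lambda>n. cmod (x n - (if n < N then x n else 0)) powr p"
    have "summable (\<lambda>n. ?f (n + N))"
      using summable_ignore_initial_segment[OF s, of N] by simp
    then have "summable ?f"
      using summable_iff_shift[of ?f N] by blast
    from suminf_split_initial_segment[OF this, of N] show ?thesis
      by simp
  qed
  then have eq: "lp_norm p (\<lambda>n. x n - (if n < N then x n else 0))
      = (\<Sum>n. cmod (x (n + N)) powr p) powr (1 / p)" for N
    unfolding lp_norm_def by simp
  have "(\<lambda>N. (\<Sum>n. cmod (x (n + N)) powr p)) \<longlonglongrightarrow> 0"
    using suminf_exist_split2[OF s] .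
  then have "(\<lambda>N. (\<Sum>n. cmod (x (n + N)) powr p) powr (1 / p)) \<longlonglongrightarrow> 0 powr (1 / p)"
    using p summable_ignore_initial_segment[OF s]
    by (intro tendsto_powr2) (auto intro!: always_eventually suminf_nonneg)
  then show ?thesis
    by (simp add: eq)
qed

text \<open>Truncations approximate \<open>y\<close>, and a truncation is a finite sum of multiples
  of unit vectors, each of which is approximated separately.\<close>

lemma lp_dense_range_basis:
  assumes f: "lp_operator p C f" and p: "1 \<le> p"
    and basis: "\<And>k c e. 1 \<le> k \<Longrightarrow> 0 < e \<Longrightarrow>
      \<exists>x\<in>lp p. lp_norm p (\<lambda>n. (if n = k then c else 0) - f x n) < e"
  shows "lp_dense_range p f"
  unfolding lp_dense_range_def
proof (intro ballI allI impI)
  fix y and e :: real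
  assume y: "y \<in> lp p" and e: "0 < e"
  define t where "t N = (\<lambda>n. if n < N then y n else 0)" for N
  have y0: "y 0 = 0"
    using y by (simp add: lp_def)
  have t: "t N \<in> lp p" for N
    unfolding t_def by (rule lp_finite_support[of "{0<..<N}"]) (use y0 p in auto)
  have approx: "\<exists>x\<in>lp p. lp_norm p (\<lambda>n. t N n - f x n) < e" if "0 < e" for N e
    using that
  proof (induction N arbitrary: e)
    case 0
    then show ?case
      using lp_operator_zero[OF f] by (intro bexI[OF _ lp_zero]) (auto simp: t_def lp_norm_zero)
  next
    case (Suc N)
    show ?case
    \<comment> \<open>Index 0 is the padding entry, where \<open>y\<close> vanishes; the hypothesis
      on unit vectors starts at index 1.\<close>
    proof (cases "N = 0")
      case True
      then have "t (Suc N) = (\<lambda>n. 0)"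
        using y0 by (auto simp: t_def fun_eq_iff)
      then show ?thesis
        using lp_operator_zero[OF f] \<open>0 < e\<close> by (intro bexI[OF _ lp_zero]) (auto simp: lp_norm_zero)
    next
      case False
      obtain u where u: "u \<in> lp p" "lp_norm p (\<lambda>n. t N n - f u n) < e / 2"
        using Suc.IH[of "e / 2"] Suc.prems by auto
      \<comment> \<open>The sign fits the difference form of linearity: adding \<open>y N\<close> is
        subtracting \<open>- y N\<close>.\<close>
      obtain v where v: "v \<in> lp p"
        "lp_norm p (\<lambda>n. (if n = N then - y N else 0) - f v n) < e / 2"
        using basis[of N "e / 2" "- y N"] False Suc.prems by auto
      have b: "(\<lambda>n. if n = N then - y N else 0) \<in> lp p"
        by (rule lp_finite_support[of "{N}"]) (use False p in auto)
      have "(\<lambda>n. t (Suc N) n - f (\<lambda>n. u n - v n) n)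
          = (\<lambda>n. (t N n - f u n) - ((if n = N then - y N else 0) - f v n))"
        using lp_operatorD(3)[OF f u(1) v(1)] by (auto simp: t_def fun_eq_iff)
      then have "lp_norm p (\<lambda>n. t (Suc N) n - f (\<lambda>n. u n - v n) n) < e"
        using lp_norm_triangle_diff[OF lp_diff[OF t lp_operatorD(1)[OF f u(1)] p]
            lp_diff[OF b lp_operatorD(1)[OF f v(1)] p] p, of N] u(2) v(2) by simp
      then show ?thesis
        using lp_diff[OF u(1) v(1) p] by blast
    qed
  qed
  obtain N where N: "lp_norm p (\<lambda>n. y n - t N n) < e / 2"
    using order_tendstoD(2)[OF lp_truncation_tendsto[OF y p], of "e / 2"] e
    by (auto simp: eventually_sequentially t_def)
  obtain x where x: "x \<in> lp p" "lp_norm p (\<lambda>n. t N n - f x n) < e / 2"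
    using approx[of "e / 2" N] e by auto
  have "lp_norm p (\<lambda>n. y n - f x n) < e"
    using lp_norm_triangle_via[OF y t lp_operatorD(1)[OF f x(1)] p, of N] N x(2) by simp
  then show "\<exists>x\<in>lp p. lp_norm p (\<lambda>n. y n - f x n) < e"
    using x(1) by blast
qed

lemma lp_dense_range_closure:
  assumes f: "\<And>x. x \<in> lp p \<Longrightarrow> f x \<in> lp p" and p: "1 \<le> p" and dense: "lp_dense_range p f"
  shows "lp_topology p closure_of (f ` lp p) = lp p"
proof -
  interpret Metric_space "lp p" "lp_dist p"
    using p by (rule Metric_space_lp)
  show ?thesis
    using dense f unfolding lp_topology_def metric_closure_of lp_dense_range_def
    by (fastforce simp: lp_dist_def)
qed

section \<open>Diagonal operators and weighted shifts\<close>

lemma lp_operator_mult: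
  assumes "\<And>n. cmod (d n) \<le> C" and "0 \<le> C" and "1 \<le> p"
  shows "lp_operator p C (\<lambda>x n. d n * x n)"
  unfolding lp_operator_def using lp_mult_bounded[of _ p C d] assms
  by (auto simp: algebra_simps)

text \<open>For \<open>n\<close> equal to 1 or 2 truncated subtraction reads the entry
  \<open>x 0\<close>, which is 0 on \<open>lp p\<close>, so zeros enter from the left without a case
  distinction.\<close>

definition wshift_right :: "(nat \<Rightarrow> complex) \<Rightarrow> (nat \<Rightarrow> complex) \<Rightarrow> (nat \<Rightarrow> complex)" where
  "wshift_right z x = (\<lambda>n. z n * x (n - 2))"

text \<open>The padding entry is set to 0 explicitly: otherwise \<open>x 2\<close> would be moved
  there and the image could leave \<open>lp p\<close>.\<close>

definition wshift_left :: "(nat \<Rightarrow> complex) \<Rightarrow> (nat \<Rightarrow> complex) \<Rightarrow> (nat \<Rightarrow> complex)" where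
  "wshift_left z x = (\<lambda>n. z n * (if n = 0 then 0 else x (n + 2)))"

lemma lp_operator_wshift_right:
  assumes z: "\<And>n. cmod (z n) \<le> C" and C: "0 \<le> C" and p: "1 \<le> p"
  shows "lp_operator p C (wshift_right z)"
proof -
  have "lp_operator p 1 (\<lambda>x n. x (n - 2))"
    unfolding lp_operator_def using lp_shift_right[OF _ p] by auto
  from lp_operator_compose[OF lp_operator_mult[OF z C p] this C] show ?thesis
    by (simp add: wshift_right_def[abs_def])
qed

lemma lp_operator_wshift_left:
  assumes z: "\<And>n. cmod (z n) \<le> C" and C: "0 \<le> C" and p: "1 \<le> p"
  shows "lp_operator p C (wshift_left z)"
proof -
  have "lp_operator p 1 (\<lambda>x n. if n = 0 then 0 else x (n + 2))"
    unfolding lp_operator_def using lp_shift_left[OF _ p] by (auto simp: fun_eq_iff)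
  from lp_operator_compose[OF lp_operator_mult[OF z C p] this C] show ?thesis
    by (simp add: wshift_left_def[abs_def])
qed

section \<open>Blocks along one parity class and the two shift factors\<close>

lemma two_periodic_eq:
  fixes z :: "nat \<Rightarrow> 'a"
  assumes "\<And>n. z (n + 2) = z n"
  shows "z (k + 2 * j) = z k"
proof (induction j)
  case (Suc j)
  then show ?case
    using assms[of "k + 2 * j"] by (simp add: algebra_simps)
qed simp

text \<open>\<open>w\<close> is a finite sequence in the coordinate \<open>j = (n - k) div 2\<close>
  on the parity class of \<open>k\<close>. There a weight of period 2 has the constant value
  \<open>z k\<close>, so a weighted shift by two places becomes \<open>z k\<close> times a shift by
  one.\<close>

definition step_block :: "nat \<Rightarrow> nat \<Rightarrow> (nat \<Rightarrow> complex) \<Rightarrow> (nat \<Rightarrow> complex)" where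
  "step_block k N w = (\<lambda>n. if k \<le> n \<and> n < k + 2 * N \<and> even (n - k) then w ((n - k) div 2) else 0)"

lemma step_block_lp:
  assumes k: "1 \<le> k" and p: "1 \<le> p"
  shows "step_block k N w \<in> lp p"
    and "lp_norm p (step_block k N w) = (\<Sum>j<N. cmod (w j) powr p) powr (1 / p)"
proof -
  let ?S = "(\<lambda>j. k + 2 * j) ` {..<N}"
  have out: "step_block k N w n = 0" if "n \<notin> ?S" for n
  proof (rule ccontr)
    assume "step_block k N w n \<noteq> 0"
    then have n: "k \<le> n" "n < k + 2 * N" "even (n - k)"
      by (auto simp: step_block_def split: if_splits)
    then have "n = k + 2 * ((n - k) div 2)" "(n - k) div 2 < N"
      by auto
    then show False
      using that by blast
  qed
  have "(\<Sum>n\<in>?S. cmod (step_block k N w n) powr p) = (\<Sum>j<N. cmod (w j) powr p)"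
    by (subst sum.reindex) (auto simp: inj_on_def step_block_def)
  moreover have "0 \<notin> ?S"
    using k by auto
  ultimately show "step_block k N w \<in> lp p"
    "lp_norm p (step_block k N w) = (\<Sum>j<N. cmod (w j) powr p) powr (1 / p)"
    using lp_finite_support[of ?S "step_block k N w" p, OF _ out _ p] by auto
qed

lemma step_block_norm_le:
  assumes k: "1 \<le> k" and p: "1 \<le> p" and w: "\<And>j. j < N \<Longrightarrow> cmod (w j) \<le> B" and B: "0 \<le> B"
  shows "lp_norm p (step_block k N w) \<le> real N powr (1 / p) * B"
proof -
  have "(\<Sum>j<N. cmod (w j) powr p) \<le> (\<Sum>j<N. B powr p)"
    using w p by (intro sum_mono powr_mono2) auto
  then have "(\<Sum>j<N. cmod (w j) powr p) powr (1 / p) \<le> (real N * B powr p) powr (1 / p)"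
    using p by (intro powr_mono2) (auto intro: sum_nonneg)
  then show ?thesis
    using p B by (simp add: step_block_lp(2)[OF k p] powr_mult powr_powr)
qed

text \<open>In the block coordinate the new entry is \<open>z k * w (j - 1) - w j\<close>. The block
  becomes one entry longer because its last entry is shifted to position \<open>N\<close>.\<close>

lemma wshift_right_minus_1_step_block:
  assumes z: "\<And>n. z (n + 2) = z n" and k: "1 \<le> k"
  shows "minus_scalar (wshift_right z) 1 (step_block k N w) =
    step_block k (Suc N) (\<lambda>j. (if j = 0 then 0 else z k * w (j - 1)) - (if j < N then w j else 0))"
proof
  fix n
  consider "n < k" | j where "n = k + 2 * j" | j where "n = k + 2 * j + 1"
  proof -
    have "n < k \<or> n = k + 2 * ((n - k) div 2) \<or> n = k + 2 * ((n - k) div 2) + 1"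
      by presburger
    then show thesis
      using that by blast
  qed
  then show "minus_scalar (wshift_right z) 1 (step_block k N w) n =
    step_block k (Suc N) (\<lambda>j. (if j = 0 then 0 else z k * w (j - 1)) - (if j < N then w j else 0)) n"
  proof cases
    case 1
    then show ?thesis
      by (auto simp: minus_scalar_def wshift_right_def step_block_def)
  next
    case (2 j)
    \<comment> \<open>For \<open>j = 0\<close> the index \<open>k + 2 * j - 2\<close> lies below
      \<open>k\<close> even where the subtraction truncates, because \<open>k\<close> is at least
      1.\<close>
    have "step_block k N w (k + 2 * j - 2) = (if j = 0 \<or> N < j then 0 else w (j - 1))"
    proof (cases j)
      case 0
      then show ?thesis
        using k by (auto simp: step_block_def)
    next
      case (Suc i)
      then have "k + 2 * j - 2 = k + 2 * i"
        by simp
      then show ?thesis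
        using Suc by (auto simp: step_block_def)
    qed
    then show ?thesis
      using 2 two_periodic_eq[of z k j, OF z]
      by (auto simp: minus_scalar_def wshift_right_def) (auto simp: step_block_def)
  next
    case (3 j)
    \<comment> \<open>For \<open>j = 0\<close> this is the index \<open>k - 1\<close>, again below
      \<open>k\<close>; otherwise the index has the wrong parity.\<close>
    have "step_block k N w (k + 2 * j + 1 - 2) = 0"
      using k by (cases j) (auto simp: step_block_def)
    then show ?thesis
      using 3 by (auto simp: minus_scalar_def wshift_right_def) (auto simp: step_block_def)
  qed
qed

text \<open>Backward substitution in \<open>z n * x (n + 2) - x n = 0\<close>, starting from
  \<open>x k = - c\<close>, runs down the parity class of \<open>k\<close> and ends at index 1 or 2,
  so the solution has finite support.\<close>

lemma basis_in_range_wshift_left_minus_1: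
  assumes z: "\<And>n. z (n + 2) = z n" and k: "1 \<le> k" and p: "1 \<le> p"
  shows "(\<lambda>n. if n = k then c else 0) \<in> minus_scalar (wshift_left z) 1 ` lp p"
proof -
  define x where
    "x = (\<lambda>n. if 1 \<le> n \<and> n \<le> k \<and> even (k - n) then - c * z k ^ ((k - n) div 2) else 0)"
  have "x \<in> lp p"
    by (rule lp_finite_support[of "{1..k}"]) (use p in \<open>auto simp: x_def\<close>)
  moreover have "minus_scalar (wshift_left z) 1 x n = (if n = k then c else 0)" for n
  proof -
    consider "n = 0" | "n = k" | "k < n" | j where "k = n + 2 * Suc j" "0 < n"
      | j where "k = n + 2 * j + 1" "0 < n"
    proof -
      assume *: "n = 0 \<Longrightarrow> thesis" "n = k \<Longrightarrow> thesis" "k < n \<Longrightarrow> thesis"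
        "\<And>j. k = n + 2 * Suc j \<Longrightarrow> 0 < n \<Longrightarrow> thesis"
        "\<And>j. k = n + 2 * j + 1 \<Longrightarrow> 0 < n \<Longrightarrow> thesis"
      show thesis
      proof (cases "n = 0 \<or> k \<le> n")
        case True
        then show ?thesis
          using * by force
      next
        case False
        have "k = n + 2 * Suc ((k - n) div 2 - 1) \<or> k = n + 2 * ((k - n) div 2) + 1"
          using False by presburger
        then show ?thesis
          using * False by blast
      qed
    qed
    then show ?thesis
    proof cases
      \<comment> \<open>Two neighbouring entries of the geometric sequence cancel; in all other
        cases at most one term of the factor is nonzero.\<close>
      case (4 j)
      then have "z n = z k"
        using two_periodic_eq[of z n "Suc j", OF z] by simp
      with 4 show ?thesis
        by (auto simp: minus_scalar_def wshift_left_def x_def)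
    qed (use k in \<open>auto simp: minus_scalar_def wshift_left_def x_def\<close>)
  qed
  ultimately show ?thesis
    by (intro image_eqI[of _ _ x]) auto
qed

text \<open>Unit vectors are attained exactly, so the error required by
  \<open>lp_dense_range_basis\<close> is 0.\<close>

lemma wshift_left_minus_1_dense_range:
  assumes z: "\<And>n. z (n + 2) = z n" and z1: "\<And>n. cmod (z n) \<le> 1" and p: "1 \<le> p"
  shows "lp_dense_range p (minus_scalar (wshift_left z) 1)"
proof (rule lp_dense_range_basis[OF lp_operator_minus_1[OF lp_operator_wshift_left[OF z1 _ p] p] p])
  fix k :: nat and c :: complex and e :: real
  assume k: "1 \<le> k" and e: "0 < e"
  obtain x where x: "x \<in> lp p" "(\<lambda>n. if n = k then c else 0) = minus_scalar (wshift_left z) 1 x"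
    using basis_in_range_wshift_left_minus_1[where z = z and c = c, OF z k p] by blast
  have "lp_norm p (\<lambda>n. (if n = k then c else 0) - minus_scalar (wshift_left z) 1 x n) = 0"
    using fun_cong[OF x(2)] by (simp add: lp_norm_zero)
  then show "\<exists>x\<in>lp p. lp_norm p (\<lambda>n. (if n = k then c else 0) - minus_scalar (wshift_left z) 1 x n) < e"
    using x(1) e by (intro bexI[of _ x]) simp_all
qed simp

text \<open>Cesaro means of the formal solution \<open>x\<^bsub>k+2j\<^esub> = - c z\<^sub>k\<^sup>j\<close> leave a defect of
  \<open>N\<close> entries of modulus at most \<open>\<bar>c\<bar> / N\<close>, which is small in norm because \<open>p > 1\<close>.\<close>

lemma wshift_right_minus_1_dense_range:
  assumes z: "\<And>n. z (n + 2) = z n" and z1: "\<And>n. cmod (z n) \<le> 1" and p: "1 < p"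
  shows "lp_dense_range p (minus_scalar (wshift_right z) 1)"
proof (rule lp_dense_range_basis[OF lp_operator_minus_1[OF lp_operator_wshift_right[OF z1]]])
  fix k :: nat and c :: complex and e :: real
  assume k: "1 \<le> k" and e: "0 < e"
  \<comment> \<open>Averaging the formal solution cut off after 1, ..., \<open>N\<close> terms gives
    the weight \<open>1 - j / N\<close>.\<close>
  define w where "w N j = - c * (1 - of_nat j / of_nat N) * z k ^ j" for N j :: nat
  \<comment> \<open>The defect: consecutive weights differ by \<open>1 / N\<close>. Its entry at
    \<open>j = 0\<close> vanishes because the weight there is 1.\<close>
  define R where "R N j = (if j = 0 then 0 else c * z k ^ j / of_nat N)" for N j :: nat
  have defect: "(\<lambda>n. (if n = k then c else 0) - minus_scalar (wshift_right z) 1 (step_block k N (w N)) n)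
      = step_block k (Suc N) (R N)" if N: "0 < N" for N
  proof
    fix n
    have R: "R N j = (if j = 0 then c else 0)
        - ((if j = 0 then 0 else z k * w N (j - 1)) - (if j < N then w N j else 0))"
      if "j < Suc N" for j
    proof (cases j)
      case 0
      then show ?thesis
        using N by (simp add: R_def w_def)
    next
      case (Suc i)
      show ?thesis
      proof (cases "j < N")
        case True
        then show ?thesis
          using N Suc by (simp add: R_def w_def field_simps)
      next
        \<comment> \<open>The last entry, \<open>j = N\<close>, lies outside the block; this agrees
          with the formula for \<open>w\<close>, whose weight \<open>1 - j / N\<close> is 0
          there.\<close>
        case False
        then have "N = Suc i"
          using that Suc by simp
        have "of_nat (Suc i) \<noteq> (0 :: complex)"
          by (simp only: of_nat_eq_0_iff)
        then show ?thesis
          using False Suc \<open>N = Suc i\<close> unfolding R_def w_def by (simp add: field_simps)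
      qed
    qed
    show "(if n = k then c else 0) - minus_scalar (wshift_right z) 1 (step_block k N (w N)) n
      = step_block k (Suc N) (R N) n"
    proof (cases "k \<le> n \<and> n < k + 2 * Suc N \<and> even (n - k)")
      case True
      then have "(n - k) div 2 < Suc N" "(n - k) div 2 = 0 \<longleftrightarrow> n = k"
        by presburger+
      with True R[of "(n - k) div 2"] show ?thesis
        unfolding wshift_right_minus_1_step_block[where z = z, OF z k]
        by (simp add: step_block_def)
    next
      case False
      then show ?thesis
        unfolding wshift_right_minus_1_step_block[where z = z, OF z k]
        by (auto simp: step_block_def)
    qed
  qed
  have zk: "cmod (z k) ^ j \<le> 1" for j
    using z1 by (simp add: power_le_one)
  have le: "lp_norm p (step_block k (Suc N) (R N)) \<le> 2 * cmod c * real (Suc N) powr (1 / p - 1)"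
    if N: "0 < N" for N
  proof -
    have "lp_norm p (step_block k (Suc N) (R N)) \<le> real (Suc N) powr (1 / p) * (cmod c / real N)"
      using k p zk by (intro step_block_norm_le)
        (auto simp: R_def norm_mult norm_divide norm_power intro!: divide_right_mono mult_left_le)
    \<comment> \<open>The defect block has \<open>N + 1\<close> positions while its entries carry
      \<open>1 / N\<close>. The inequality \<open>N + 1 \<le> 2 * N\<close> merges both into one
      power and is the origin of the factor 2.\<close>
    also have "\<dots> \<le> real (Suc N) powr (1 / p) * (2 * cmod c / real (Suc N))"
    proof (rule mult_left_mono)
      have "real (Suc N) \<le> 2 * real N"
        using N by simp
      then have "cmod c * real (Suc N) \<le> cmod c * (2 * real N)"
        by (rule mult_left_mono) simp
      then show "cmod c / real N \<le> 2 * cmod c / real (Suc N)"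
        using N by (simp add: divide_simps mult_ac del: of_nat_Suc)
    qed simp
    also have "\<dots> = 2 * cmod c * real (Suc N) powr (1 / p - 1)"
      by (simp add: powr_diff del: of_nat_Suc)
    finally show ?thesis .
  qed
  have "(\<lambda>N. real (Suc N) powr (1 / p - 1)) \<longlonglongrightarrow> 0"
    using p by (intro tendsto_neg_powr filterlim_compose[OF filterlim_real_sequentially filterlim_Suc]) auto
  then have "(\<lambda>N. 2 * cmod c * real (Suc N) powr (1 / p - 1)) \<longlonglongrightarrow> 0"
    by (rule tendsto_mult_right_zero)
  then have "eventually (\<lambda>N. 2 * cmod c * real (Suc N) powr (1 / p - 1) < e) sequentially"
    using e by (rule order_tendstoD)
  then obtain N where "0 < N" "2 * cmod c * real (Suc N) powr (1 / p - 1) < e"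
    using eventually_happens'[OF _ eventually_conj[OF eventually_gt_at_top[of 0]]] sequentially_bot
    by blast
  then have "lp_norm p (\<lambda>n. (if n = k then c else 0)
      - minus_scalar (wshift_right z) 1 (step_block k N (w N)) n) < e"
    using le[of N] defect[of N] by simp
  then show "\<exists>x\<in>lp p. lp_norm p (\<lambda>n. (if n = k then c else 0) - minus_scalar (wshift_right z) 1 x n) < e"
    using step_block_lp(1)[OF k] p by (intro bexI[of _ "step_block k N (w N)"]) auto
qed (use p in auto)

text \<open>For a geometric block all inner entries of the image cancel. Only the first and the last
  survive, each of modulus \<open>(N + 1) powr (- 1 / p)\<close>, so the image has norm
  \<open>2 powr (1 / p)\<close> times this number.\<close>

lemma wshift_right_minus_1_weyl_sequence:
  assumes z: "\<And>n. z (n + 2) = z n" and k: "1 \<le> k" and zk: "cmod (z k) = 1" and p: "1 \<le> p"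
  shows "weyl_sequence p (minus_scalar (wshift_right z) 1)
    (\<lambda>N. step_block k (Suc N) (\<lambda>j. complex_of_real (real (Suc N) powr (- 1 / p)) * z k ^ j))"
    (is "weyl_sequence p _ (\<lambda>N. ?b N)")
  unfolding weyl_sequence_def
proof (intro conjI allI)
  fix N
  show "?b N \<in> lp p"
    using k p by (rule step_block_lp)
  have "cmod (complex_of_real (real (Suc N) powr (- 1 / p)) * z k ^ j) = real (Suc N) powr (- 1 / p)" for j
    by (simp add: norm_mult norm_power zk)
  moreover have "real (Suc N) * (real (Suc N) powr (- 1 / p)) powr p = 1"
    using p by (simp add: powr_powr powr_neg_one del: of_nat_Suc)
  ultimately show "lp_norm p (?b N) = 1"
    by (simp add: step_block_lp(2)[OF k p] del: of_nat_Suc sum.lessThan_Suc)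
next
  define a where "a N = real (Suc N) powr (- 1 / p)" for N
  have "lp_norm p (minus_scalar (wshift_right z) 1 (?b N)) \<le> 2 powr (1 / p) * a N" for N
  proof -
    define v where "v j = (if j = 0 then 0 else z k * (complex_of_real (a N) * z k ^ (j - 1)))
      - (if j < Suc N then complex_of_real (a N) * z k ^ j else 0)" for j
    have a: "0 \<le> a N"
      by (simp add: a_def)
    have v: "cmod (v j) powr p = (if j = 0 \<or> j = Suc N then a N powr p else 0)" if "j < Suc (Suc N)" for j
    proof (cases j)
      case 0
      then show ?thesis
        using a by (simp add: v_def)
    next
      case (Suc i)
      then show ?thesis
        using a zk that by (auto simp: v_def norm_mult norm_power)
    qed
    have "(\<Sum>j<Suc (Suc N). cmod (v j) powr p) = (\<Sum>j<Suc (Suc N). if j = 0 \<or> j = Suc N then a N powr p else 0)"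
      using v by (intro sum.cong) auto
    also have "\<dots> = (\<Sum>j\<in>{0, Suc N}. a N powr p)"
      by (rule sum.mono_neutral_cong_right) auto
    also have "\<dots> = 2 * a N powr p"
      by simp
    finally have sum_v: "(\<Sum>j<Suc (Suc N). cmod (v j) powr p) = 2 * a N powr p" .
    have "lp_norm p (minus_scalar (wshift_right z) 1 (?b N))
        = (\<Sum>j<Suc (Suc N). cmod (v j) powr p) powr (1 / p)"
      unfolding wshift_right_minus_1_step_block[where z = z, OF z k] step_block_lp(2)[OF k p]
        v_def a_def by (rule refl)
    also have "\<dots> = 2 powr (1 / p) * a N"
      using p a by (simp only: sum_v) (simp add: powr_mult powr_powr)
    finally show ?thesis
      by simp
  qed
  then have "eventually (\<lambda>N. norm (lp_norm p (minus_scalar (wshift_right z) 1 (?b N)))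
      \<le> 2 powr (1 / p) * a N) sequentially"
    by simp
  moreover have "(\<lambda>N. 2 powr (1 / p) * a N) \<longlonglongrightarrow> 0"
    unfolding a_def using p
    by (intro tendsto_mult_right_zero tendsto_neg_powr
        filterlim_compose[OF filterlim_real_sequentially filterlim_Suc]) auto
  ultimately show "(\<lambda>N. lp_norm p (minus_scalar (wshift_right z) 1 (?b N))) \<longlonglongrightarrow> 0"
    by (rule Lim_null_comparison)
qed

section \<open>Weyl sequences of products and failure of surjectivity\<close>

text \<open>It is the inner factor \<open>g\<close> that makes the images small; the bounded outer
  factor \<open>f\<close> keeps them small.\<close>

lemma weyl_sequence_compose:
  assumes f: "lp_operator p C f" and g: "\<And>x. x \<in> lp p \<Longrightarrow> g x \<in> lp p"
    and x: "weyl_sequence p g x"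
  shows "weyl_sequence p (\<lambda>x. f (g x)) x"
proof -
  have "lp_norm p (f (g (x k))) \<le> C * lp_norm p (g (x k))" for k
    using x by (intro lp_operatorD(2)[OF f] g) (simp add: weyl_sequence_def)
  then have "eventually (\<lambda>k. norm (lp_norm p (f (g (x k)))) \<le> C * lp_norm p (g (x k))) sequentially"
    by simp
  moreover have "(\<lambda>k. C * lp_norm p (g (x k))) \<longlonglongrightarrow> 0"
    using x by (intro tendsto_mult_right_zero) (simp add: weyl_sequence_def)
  ultimately have "(\<lambda>k. lp_norm p (f (g (x k)))) \<longlonglongrightarrow> 0"
    by (rule Lim_null_comparison)
  then show ?thesis
    using x by (simp add: weyl_sequence_def)
qed

lemma weyl_sequence_bounded_below:
  assumes m: "0 < m" and g: "\<And>x. x \<in> lp p \<Longrightarrow> m * lp_norm p x \<le> lp_norm p (g x)"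
  shows "\<not> weyl_sequence p g x"
proof
  assume x: "weyl_sequence p g x"
  then have "m \<le> lp_norm p (g (x k))" for k
    using g[of "x k"] by (simp add: weyl_sequence_def)
  moreover have "(\<lambda>k. lp_norm p (g (x k))) \<longlonglongrightarrow> 0"
    using x by (simp add: weyl_sequence_def)
  ultimately have "m \<le> 0"
    by (intro LIMSEQ_le_const) auto
  then show False
    using m by simp
qed

text \<open>For \<open>y\<^bsub>k+2j\<^esub> = z\<^sub>k\<^bsup>-j\<^esup> / (k + 2j)\<close> the equation \<open>z\<^sub>n u\<^bsub>n+2\<^esub> - u\<^sub>n = y\<^sub>n\<close>
  telescopes to \<open>z\<^sub>k\<^sup>N u\<^bsub>k+2N\<^esub> - u\<^sub>k = \<Sum>j<N. 1 / (k + 2j)\<close>, so \<open>u\<close> is unbounded.\<close>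

lemma wshift_left_minus_1_not_surj:
  assumes z: "\<And>n. z (n + 2) = z n" and k: "1 \<le> k" and zk: "cmod (z k) = 1" and p: "1 < p"
  shows "minus_scalar (wshift_left z) 1 ` lp p \<noteq> lp p"
proof
  assume surj: "minus_scalar (wshift_left z) 1 ` lp p = lp p"
  define y where "y = (\<lambda>n. if k \<le> n \<and> even (n - k) then inverse (z k) ^ ((n - k) div 2) / of_nat n else 0)"
  \<comment> \<open>At \<open>n = 0\<close> both sides are 0, since \<open>k\<close> is at least 1.
    Elsewhere \<open>y n\<close> has modulus at most \<open>1 / n\<close>, which is p-summable
    because \<open>p > 1\<close>.\<close>
  have "cmod (y n) powr p \<le> real n powr - p" for n
  proof (cases "n = 0")
    case True
    then show ?thesis
      using k by (simp add: y_def)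
  next
    case False
    then have "cmod (y n) \<le> inverse (real n)"
      using zk by (auto simp: y_def norm_divide norm_power norm_inverse inverse_eq_divide)
    then have "cmod (y n) powr p \<le> inverse (real n) powr p"
      using p by (intro powr_mono2) auto
    also have "\<dots> = real n powr - p"
      by (simp add: powr_minus inverse_powr)
    finally show ?thesis .
  qed
  moreover have "summable (\<lambda>n. real n powr - p)"
    using p by (simp add: summable_real_powr_iff)
  ultimately have "summable (\<lambda>n. cmod (y n) powr p)"
    using summable_comparison_test'[of "\<lambda>n. real n powr - p" 0 "\<lambda>n. cmod (y n) powr p"]
    by simp
  then have "y \<in> lp p"
    using k by (simp add: lp_def y_def)
  then have "y \<in> minus_scalar (wshift_left z) 1 ` lp p"
    by (simp only: surj)
  then obtain u where u: "u \<in> lp p" and y_eq: "y = minus_scalar (wshift_left z) 1 u"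
    by blast
  have z0: "z k \<noteq> 0"
    using zk by auto
  have step: "z k ^ Suc j * u (k + 2 * Suc j) - z k ^ j * u (k + 2 * j) = 1 / of_nat (k + 2 * j)" for j
  proof -
    have "z k * u (k + 2 * Suc j) - u (k + 2 * j) = inverse (z k) ^ j / of_nat (k + 2 * j)"
      using fun_cong[OF y_eq, of "k + 2 * j"] k two_periodic_eq[of z k j, OF z]
      by (simp add: y_def minus_scalar_def wshift_left_def add_ac)
    then have "z k ^ j * (z k * u (k + 2 * Suc j) - u (k + 2 * j))
        = z k ^ j * (inverse (z k) ^ j / of_nat (k + 2 * j))"
      by (rule arg_cong)
    then show ?thesis
      using z0 by (simp add: algebra_simps power_inverse)
  qed
  have tele: "(\<Sum>j<N. 1 / of_nat (k + 2 * j)) = z k ^ N * u (k + 2 * N) - u k" for N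
    using sum_lessThan_telescope[of "\<lambda>j. z k ^ j * u (k + 2 * j)" N] by (simp only: step) simp
  have "(\<Sum>j<N. 1 / real (k + 2 * j)) \<le> 2 * lp_norm p u" for N
  proof -
    have "(\<Sum>j<N. 1 / real (k + 2 * j)) = cmod (complex_of_real (\<Sum>j<N. 1 / real (k + 2 * j)))"
      by (simp only: norm_of_real) (simp add: sum_nonneg)
    also have "complex_of_real (\<Sum>j<N. 1 / real (k + 2 * j)) = z k ^ N * u (k + 2 * N) - u k"
      using tele[of N] by simp
    also have "cmod \<dots> \<le> cmod (u (k + 2 * N)) + cmod (u k)"
      using norm_triangle_ineq4[of "z k ^ N * u (k + 2 * N)" "u k"] zk by (simp add: norm_mult norm_power)
    also have "\<dots> \<le> 2 * lp_norm p u"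
      using norm_component_le_lp_norm[OF u, of k] norm_component_le_lp_norm[OF u, of "k + 2 * N"] p
      by simp
    finally show ?thesis .
  qed
  then have "summable (\<lambda>j. 1 / real (k + 2 * j))"
    by (intro summableI_nonneg_bounded) auto
  then have sm: "summable (\<lambda>j. real (k + 2) * (1 / real (k + 2 * j)))"
    by (rule summable_mult)
  \<comment> \<open>Comparison with the harmonic series through
    \<open>k + 2 * j \<le> (k + 2) * (j + 1)\<close>.\<close>
  have "inverse (real (Suc j)) \<le> real (k + 2) * (1 / real (k + 2 * j))" for j
  proof -
    have "k + 2 * j \<le> (k + 2) * Suc j"
      by simp
    then have "real (k + 2 * j) \<le> real (k + 2) * real (Suc j)"
      by (simp only: of_nat_mult[symmetric] of_nat_le_iff)
    moreover have "0 < real (k + 2 * j)"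
      using k by simp
    ultimately show ?thesis
      by (simp add: divide_simps mult_ac del: of_nat_Suc of_nat_add)
  qed
  then have "summable (\<lambda>j. inverse (real (Suc j)))"
    using summable_comparison_test'[OF sm, of 0 "\<lambda>j. inverse (real (Suc j))"] by simp
  then have "summable (\<lambda>n. inverse (real n))"
    by (subst (asm) summable_Suc_iff)
  then show False
    using not_summable_harmonic[where 'a = real] by simp
qed

section \<open>The Joukowsky map and the spectral parameter\<close>

text \<open>The two roots of \<open>t\<^sup>2 - w * t + 1\<close> have product 1, so one of them
  lies in the closed unit disc.\<close>

lemma joukowsky_root:
  fixes w :: complex
  obtains \<zeta> where "\<zeta> \<noteq> 0" "cmod \<zeta> \<le> 1" "\<zeta> + inverse \<zeta> = w"
proof -
  define t where "t = (w + csqrt (w\<^sup>2 - 4)) / 2"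
  have "t * (w - t) = (w\<^sup>2 - (csqrt (w\<^sup>2 - 4))\<^sup>2) / 4"
    by (simp add: t_def field_simps power2_eq_square)
  then have t: "t * (w - t) = 1"
    by simp
  then have "t \<noteq> 0"
    by auto
  then have inv: "inverse t = w - t"
    using t by (simp add: field_simps)
  show ?thesis
  proof (cases "cmod t \<le> 1")
    case True
    then show ?thesis
      using that[of t] \<open>t \<noteq> 0\<close> inv by simp
  next
    case False
    then have "cmod (inverse t) \<le> 1"
      by (simp add: norm_inverse inverse_le_1_iff)
    moreover have "inverse t + t = w"
      using inv by simp
    ultimately show ?thesis
      using that[of "inverse t"] \<open>t \<noteq> 0\<close> by simp
  qed
qed

text \<open>On the unit circle the inverse is the conjugate, so the sum is
  \<open>2 * Re \<zeta>\<close>. Conversely \<open>\<zeta>\<close> is a root of a real quadratic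
  with constant term 1 and nonpositive discriminant: one of a conjugate pair, or a double root 1 or
  -1.\<close>

lemma joukowsky_unit_circle:
  fixes \<zeta> :: complex
  assumes z0: "\<zeta> \<noteq> 0" and w: "\<zeta> + inverse \<zeta> = w"
  shows "cmod \<zeta> = 1 \<longleftrightarrow> (\<exists>t\<in>{-2..2}. w = complex_of_real t)"
proof
  assume "cmod \<zeta> = 1"
  then have "\<zeta> + inverse \<zeta> = complex_of_real (2 * Re \<zeta>)"
    by (simp add: inverse_complex_def complex_add_cnj complex_eq_iff cmod_power2[symmetric])
  moreover have "\<bar>Re \<zeta>\<bar> \<le> 1"
    using abs_Re_le_cmod[of \<zeta>] \<open>cmod \<zeta> = 1\<close> by simp
  ultimately show "\<exists>t\<in>{-2..2}. w = complex_of_real t"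
    using w by (intro bexI[of _ "2 * Re \<zeta>"]) (auto simp: abs_le_iff)
next
  assume "\<exists>t\<in>{-2..2}. w = complex_of_real t"
  then obtain t where t: "-2 \<le> t" "t \<le> 2" "w = complex_of_real t"
    by auto
  have "\<zeta> * \<zeta> + 1 = of_real t * \<zeta>"
    using w t z0 by (simp add: field_simps)
  then have re: "Re \<zeta> * Re \<zeta> - Im \<zeta> * Im \<zeta> + 1 = t * Re \<zeta>" and im: "2 * Re \<zeta> * Im \<zeta> = t * Im \<zeta>"
    by (auto simp: complex_eq_iff)
  have "(Re \<zeta>)\<^sup>2 + (Im \<zeta>)\<^sup>2 = 1"
  proof (cases "Im \<zeta> = 0")
    \<comment> \<open>A real root makes the discriminant \<open>t\<^sup>2 - 4\<close> a square;
      being nonpositive, it is 0.\<close>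
    case True
    have "0 \<le> (2 - t) * (2 + t)"
      using t by simp
    then have "t\<^sup>2 \<le> 4"
      by (simp add: power2_eq_square algebra_simps)
    moreover have "(2 * Re \<zeta> - t)\<^sup>2 = t\<^sup>2 - 4"
      using re True by (simp add: power2_eq_square algebra_simps)
    ultimately have "(2 * Re \<zeta> - t)\<^sup>2 = 0"
      using zero_le_power2[of "2 * Re \<zeta> - t"] by linarith
    then have tt: "t = 2 * Re \<zeta>"
      by simp
    then show ?thesis
      using re True by (simp add: power2_eq_square)
  next
    case False
    then have "t = 2 * Re \<zeta>"
      using im by simp
    then show ?thesis
      using re by (simp add: power2_eq_square)
  qed
  then show "cmod \<zeta> = 1"
    by (simp add: cmod_def)
qed

text \<open>The affine change \<open>w = (\<mu> - r) / s\<close> carries the interval to [-2, 2],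
  where \<open>joukowsky_unit_circle\<close> applies.\<close>

lemma spectral_parameter:
  fixes r s :: real and \<mu> :: complex
  assumes s: "0 < s"
  obtains \<zeta> where "\<zeta> \<noteq> 0" "cmod \<zeta> \<le> 1" "of_real s * (\<zeta> + inverse \<zeta>) = \<mu> - of_real r"
    "cmod \<zeta> = 1 \<longleftrightarrow> \<mu> \<in> complex_interval (r - 2 * s) (r + 2 * s)"
proof -
  obtain \<zeta> where \<zeta>: "\<zeta> \<noteq> 0" "cmod \<zeta> \<le> 1" "\<zeta> + inverse \<zeta> = (\<mu> - of_real r) / of_real s"
    by (rule joukowsky_root)
  have "(\<exists>t\<in>{-2..2}. (\<mu> - of_real r) / of_real s = complex_of_real t)
      \<longleftrightarrow> \<mu> \<in> complex_interval (r - 2 * s) (r + 2 * s)"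
  proof
    assume "\<exists>t\<in>{-2..2}. (\<mu> - of_real r) / of_real s = complex_of_real t"
    then obtain t where t: "-2 \<le> t" "t \<le> 2" "(\<mu> - of_real r) / of_real s = complex_of_real t"
      by auto
    then have "\<mu> = complex_of_real (r + s * t)"
      using s by (simp add: field_simps)
    moreover have "s * t \<le> s * 2" "- (s * 2) \<le> s * t"
      using t s mult_left_mono[of "-2" t s] by auto
    ultimately show "\<mu> \<in> complex_interval (r - 2 * s) (r + 2 * s)"
      unfolding complex_interval_def by (intro image_eqI[of _ _ "r + s * t"]) auto
  next
    assume "\<mu> \<in> complex_interval (r - 2 * s) (r + 2 * s)"
    then obtain v where "r - 2 * s \<le> v" "v \<le> r + 2 * s" "\<mu> = of_real v"
      by (auto simp: complex_interval_def)
    then show "\<exists>t\<in>{-2..2}. (\<mu> - of_real r) / of_real s = complex_of_real t"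
      using s by (intro bexI[of _ "(v - r) / s"]) (auto simp: field_simps)
  qed
  then show ?thesis
    using that[of \<zeta>] \<zeta> s joukowsky_unit_circle[OF \<zeta>(1,3)] by (simp add: field_simps)
qed

section \<open>Factorization of \<open>T0\<close> and the three spectra\<close>

text \<open>A shift by two places preserves parity, so \<open>n\<close> and \<open>n + 2\<close>
  carry the same weight and the claim becomes a scalar identity in \<open>x (n - 2)\<close>,
  \<open>x n\<close> and \<open>x (n + 2)\<close> for each parity.\<close>

lemma T0_factorization:
  assumes z: "\<And>n. z n = (if odd n then a else b)" and d: "\<And>n. d n = - of_real (if odd n then s1 else s2) / z n"
    and a: "a \<noteq> 0" "of_real s1 * (a + inverse a) = \<mu> - of_real r1"
    and b: "b \<noteq> 0" "of_real s2 * (b + inverse b) = \<mu> - of_real r2"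
    and x: "x \<in> lp p"
  shows "minus_scalar (T0 r1 r2 s1 s2) \<mu> x =
    (\<lambda>n. d n * minus_scalar (wshift_left z) 1 (minus_scalar (wshift_right z) 1 x) n)"
proof
  fix n
  have x0: "x 0 = 0"
    using x by (simp add: lp_def)
  have \<mu>: "\<mu> = of_real r1 + of_real s1 * (a + inverse a)" "\<mu> = of_real r2 + of_real s2 * (b + inverse b)"
    using a(2) b(2) by (simp_all add: algebra_simps)
  \<comment> \<open>\<open>X\<close>, \<open>Y\<close>, \<open>W\<close> stand for
    \<open>x (n - 2)\<close>, \<open>x n\<close>, \<open>x (n + 2)\<close>, and \<open>c\<close> for
    the weight of the parity in question.\<close>
  have *: "of_real s * X + of_real r * Y + of_real s * W - (of_real r + of_real s * (c + inverse c)) * Y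
      = - of_real s / c * (c * (c * Y - W) - (c * X - Y))"
    if "c \<noteq> 0" for X Y W c :: complex and r s :: real
    using that by (simp add: field_simps)
  show "minus_scalar (T0 r1 r2 s1 s2) \<mu> x n =
    d n * minus_scalar (wshift_left z) 1 (minus_scalar (wshift_right z) 1 x) n"
  proof (cases "n = 0")
    \<comment> \<open>At the padding index the left shift gives 0, and all other terms contain
      \<open>x 0\<close>.\<close>
    case True
    then show ?thesis
      using x0 by (simp add: minus_scalar_def T0_def wshift_left_def wshift_right_def)
  next
    case False
    show ?thesis
    proof (cases "odd n")
      case True
      then show ?thesis
        using *[OF a(1), of s1 "x (n - 2)" r1 "x n" "x (n + 2)"] False d z
        unfolding \<mu>(1) by (simp add: minus_scalar_def T0_def wshift_left_def wshift_right_def)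
    next
      case even: False
      then show ?thesis
        using *[OF b(1), of s2 "x (n - 2)" r2 "x n" "x (n + 2)"] False d z
        unfolding \<mu>(2) by (simp add: minus_scalar_def T0_def wshift_left_def wshift_right_def)
    qed
  qed
qed

theorem corollary3p9:
  fixes p r1 r2 s1 s2 :: real
  assumes "1 < p" and "0 \<le> r1" and "0 \<le> r2" and "0 < s1" and "0 < s2"
  shows "sigma_co p (T0 r1 r2 s1 s2) = {} \<and>
         sigma_app p (T0 r1 r2 s1 s2) =
           complex_interval (r1 - 2 * s1) (r1 + 2 * s1) \<union> complex_interval (r2 - 2 * s2) (r2 + 2 * s2) \<and>
         sigma_delta p (T0 r1 r2 s1 s2) =
           complex_interval (r1 - 2 * s1) (r1 + 2 * s1) \<union> complex_interval (r2 - 2 * s2) (r2 + 2 * s2)"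
proof -
  let ?I = "complex_interval (r1 - 2 * s1) (r1 + 2 * s1) \<union> complex_interval (r2 - 2 * s2) (r2 + 2 * s2)"
  let ?T = "T0 r1 r2 s1 s2"
  note p = \<open>1 < p\<close>
  have p1: "1 \<le> p"
    using p by simp
  have "\<mu> \<notin> sigma_co p ?T \<and> (\<mu> \<in> sigma_app p ?T \<longleftrightarrow> \<mu> \<in> ?I) \<and> (\<mu> \<in> sigma_delta p ?T \<longleftrightarrow> \<mu> \<in> ?I)" for \<mu>
  proof -
    obtain a where a: "a \<noteq> 0" "cmod a \<le> 1" "of_real s1 * (a + inverse a) = \<mu> - of_real r1"
      and aI: "cmod a = 1 \<longleftrightarrow> \<mu> \<in> complex_interval (r1 - 2 * s1) (r1 + 2 * s1)"
      using spectral_parameter[OF \<open>0 < s1\<close>] by blast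
    obtain b where b: "b \<noteq> 0" "cmod b \<le> 1" "of_real s2 * (b + inverse b) = \<mu> - of_real r2"
      and bI: "cmod b = 1 \<longleftrightarrow> \<mu> \<in> complex_interval (r2 - 2 * s2) (r2 + 2 * s2)"
      using spectral_parameter[OF \<open>0 < s2\<close>] by blast
    define z where "z n = (if odd n then a else b)" for n :: nat
    define d where "d n = - of_real (if odd n then s1 else s2) / z n" for n
    define D where "D x = (\<lambda>n. d n * x n)" for x
    define D' where "D' x = (\<lambda>n. inverse (d n) * x n)" for x
    define L where "L = minus_scalar (wshift_left z) 1"
    define R where "R = minus_scalar (wshift_right z) 1"
    \<comment> \<open>\<open>d\<close> takes only the values \<open>d 1\<close> and
      \<open>d 2\<close>, so their moduli bound it; the summand 1 makes the bound visibly
      positive.\<close>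
    define K where "K = cmod (d 1) + cmod (d 2) + 1"
    define K' where "K' = cmod (inverse (d 1)) + cmod (inverse (d 2)) + 1"
    have z: "z (n + 2) = z n" for n
      by (simp add: z_def)
    have z1: "cmod (z n) \<le> 1" for n
      using a b by (simp add: z_def)
    have d_cases: "d n = (if odd n then d 1 else d 2)" for n
      by (simp add: d_def z_def)
    have d0: "d n \<noteq> 0" for n
      using a(1) b(1) \<open>0 < s1\<close> \<open>0 < s2\<close> by (simp add: d_def z_def)
    have K: "0 < K" "cmod (d n) \<le> K" for n
      by (auto simp: K_def d_cases[of n] add_nonneg_pos)
    have K': "0 < K'" "cmod (inverse (d n)) \<le> K'" for n
      by (auto simp: K'_def d_cases[of n] add_nonneg_pos)
    have D: "lp_operator p K D"
      unfolding D_def[abs_def] using K p1 by (intro lp_operator_mult) (auto intro: less_imp_le)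
    have D': "lp_operator p K' D'"
      unfolding D'_def[abs_def] using K' p1 by (intro lp_operator_mult) (auto intro: less_imp_le)
    have D'D: "D' (D x) = x" and DD': "D (D' x) = x" for x
      using d0 by (auto simp: D_def D'_def fun_eq_iff)
    have L: "lp_operator p 2 L" and R: "lp_operator p 2 R"
      using lp_operator_minus_1[OF lp_operator_wshift_left[OF z1 _ p1] p1]
        lp_operator_minus_1[OF lp_operator_wshift_right[OF z1 _ p1] p1]
      by (simp_all add: L_def R_def)
    have D_surj: "D ` lp p = lp p"
    proof
      show "lp p \<subseteq> D ` lp p"
        using lp_operatorD(1)[OF D'] DD' by (metis image_eqI subsetI)
    qed (use lp_operatorD(1)[OF D] in blast)
    have T: "minus_scalar ?T \<mu> x = D (L (R x))" if "x \<in> lp p" for x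
      unfolding D_def L_def R_def by (rule T0_factorization[OF z_def d_def a(1,3) b(1,3) that])
    have T_image: "minus_scalar ?T \<mu> ` lp p = D ` L ` R ` lp p"
      using T by (simp add: image_image)
    have DL: "lp_operator p (K * 2) (\<lambda>x. D (L x))"
      using K by (intro lp_operator_compose[OF D L]) simp
    have DLR: "lp_operator p (K * 2 * 2) (\<lambda>x. D (L (R x)))"
      using K by (intro lp_operator_compose[OF DL R]) simp

    \<comment> \<open>The density argument is uniform in \<open>\<mu>\<close>: both shift factors
      have dense range for all weights of modulus at most 1.\<close>
    have "lp_dense_range p L" "lp_dense_range p R"
      unfolding L_def R_def
      by (rule wshift_left_minus_1_dense_range[where z = z, OF z z1 p1]
          wshift_right_minus_1_dense_range[where z = z, OF z z1 p])+
    then have dense: "lp_dense_range p (\<lambda>x. D (L (R x)))"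
      using K(1) p1 lp_dense_range_surj[OF D_surj]
      by (intro lp_dense_range_compose[OF DL R] lp_dense_range_compose[OF D L]) simp_all
    have "lp_topology p closure_of ((\<lambda>x. D (L (R x))) ` lp p) = lp p"
      by (intro lp_dense_range_closure[OF _ p1 dense] lp_operatorD(1)[OF DLR])
    then have co: "\<mu> \<notin> sigma_co p ?T"
      by (simp add: sigma_co_def T_image image_image)

    have app: "\<mu> \<in> sigma_app p ?T" and delta: "\<mu> \<in> sigma_delta p ?T" if "\<mu> \<in> ?I"
    proof -
      \<comment> \<open>Index 1 or 2 selects a parity class whose weight is unimodular.\<close>
      have "\<exists>k\<ge>1. cmod (z k) = 1"
      proof (cases "cmod a = 1")
        case True
        then show ?thesis
          by (intro exI[of _ 1]) (simp add: z_def)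
      next
        case False
        then have "cmod b = 1"
          using that aI bI by blast
        then show ?thesis
          by (intro exI[of _ 2]) (simp add: z_def)
      qed
      then obtain k where k: "1 \<le> k" "cmod (z k) = 1"
        by blast
      obtain x where x: "weyl_sequence p R x"
        using wshift_right_minus_1_weyl_sequence[where z = z, OF z k p1] unfolding R_def by blast
      have "weyl_sequence p (\<lambda>x. D (L (R x))) x"
        by (intro weyl_sequence_compose[OF DL _ x] lp_operatorD(1)[OF R])
      then have "weyl_sequence p (minus_scalar ?T \<mu>) x"
        by (simp add: weyl_sequence_def T)
      then show "\<mu> \<in> sigma_app p ?T"
        unfolding sigma_app_def by blast
      have "L ` lp p \<noteq> lp p"
        unfolding L_def by (rule wshift_left_minus_1_not_surj[where z = z, OF z k p])
      then obtain y where y: "y \<in> lp p" "y \<notin> L ` lp p"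
        using lp_operatorD(1)[OF L] by blast
      \<comment> \<open>\<open>D\<close> is injective, with inverse \<open>D'\<close>, so a vector
        outside the range of \<open>L\<close> yields one outside the range of the product.\<close>
      have "D y \<notin> D ` L ` R ` lp p"
      proof
        assume "D y \<in> D ` L ` R ` lp p"
        then obtain x where "x \<in> lp p" "D y = D (L (R x))"
          by blast
        then have "y = L (R x)" "R x \<in> lp p"
          using D'D lp_operatorD(1)[OF R] by metis+
        then show False
          using y by blast
      qed
      then show "\<mu> \<in> sigma_delta p ?T"
        using lp_operatorD(1)[OF D y(1)] by (auto simp: sigma_delta_def T_image)
    qed

    have not_app: "\<mu> \<notin> sigma_app p ?T" and not_delta: "\<mu> \<notin> sigma_delta p ?T" if "\<mu> \<notin> ?I"
    proof -
      \<comment> \<open>Outside both intervals the two weights have modulus below 1, so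
        \<open>q\<close> is a contraction constant for both weighted shifts.\<close>
      define q where "q = max (cmod a) (cmod b)"
      have q: "0 \<le> q" "q < 1"
        using that a(2) b(2) aI bI by (auto simp: q_def less_le le_max_iff_disj)
      have zq: "cmod (z n) \<le> q" for n
        by (simp add: z_def q_def)
      note contr = lp_operator_wshift_left[OF zq q(1) p1] lp_operator_wshift_right[OF zq q(1) p1]
      have "L ` lp p = lp p" "R ` lp p = lp p"
        unfolding L_def R_def by (rule contraction_minus_1_surj[OF _ q p1], rule contr)+
      then show "\<mu> \<notin> sigma_delta p ?T"
        by (simp add: sigma_delta_def T_image D_surj)
      \<comment> \<open>Each shift factor is bounded below by \<open>1 - q\<close>, and the diagonal
        factor by \<open>1 / K'\<close>.\<close>
      have "(1 - q) * ((1 - q) / K') * lp_norm p x \<le> lp_norm p (minus_scalar ?T \<mu> x)" if x: "x \<in> lp p" for x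
      proof -
        note Rx = lp_operatorD(1)[OF R x]
        note LRx = lp_operatorD(1)[OF L Rx]
        have "(1 - q) * ((1 - q) * lp_norm p x) \<le> (1 - q) * lp_norm p (R x)"
          using contraction_minus_1_bounded_below[OF contr(2) p1 x] q
          by (intro mult_left_mono) (auto simp: R_def)
        also have "\<dots> \<le> lp_norm p (L (R x))"
          using contraction_minus_1_bounded_below[OF contr(1) p1 Rx] by (simp add: L_def)
        also have "\<dots> \<le> K' * lp_norm p (D (L (R x)))"
          using lp_operatorD(2)[OF D' lp_operatorD(1)[OF D LRx]] by (simp add: D'D)
        finally show ?thesis
          using K'(1) by (simp add: T[OF x] field_simps)
      qed
      moreover have "0 < (1 - q) * ((1 - q) / K')"
        using q K' by simp
      ultimately show "\<mu> \<notin> sigma_app p ?T"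
        using weyl_sequence_bounded_below unfolding sigma_app_def by blast
    qed
    show ?thesis
      using co app delta not_app not_delta by blast
  qed
  then show ?thesis
    by blast
qed

end
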